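(* Let $L$ be an arbitrary countable language and let $\mathcal{M}$ be a countable infinite $L$-structure. If $\mathcal{M}$ has trivial definable closure, then there is an invariant probability measure $\mu$ on $S_L$ that is concentrated on $\mathcal{M}$.
   Context: $L$ may contain relation, constant and function symbols. $S_L$ is the set of $L$-structures with underlying set $\mathbb{N}$, with the Borel $\sigma$-algebra generated by the sets $\{\mathcal{N}: R^{\mathcal{N}}(n_1,\dots,n_j)\}$, $\{\mathcal{N}: c^{\mathcal{N}}=\ell\}$, $\{\mathcal{N}: f^{\mathcal{N}}(n_1,\dots,n_k)=\ell\}$. A measure on $S_L$ is invariant if it is invariant under the logic action of $\mathrm{Sym}(\mathbb{N})$ (induced by permuting $\mathbb{N}$), and concentrated on $\mathcal{M}$ if it gives measure $1$ to the set of structures in $S_L$ isomorphic to $\mathcal{M}$. $\mathcal{M}$ has trivial definable closure if for every finite tuple $\mathbf{a}$ in $\mathcal{M}$, the elements fixed by all automorphisms of $\mathcal{M}$ fixing $\mathbf{a}$ pointwise are exactly the entries of $\mathbf{a}$. *)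

theory Defs
  imports "HOL-Probability.Probability"
begin

text \<open>
  Symbol sets are sets, not types, so that there may be no symbols of a given kind. Arities are
  arbitrary natural numbers: nullary relation and function symbols are permitted.
\<close>

record ('r, 'c, 'f) language =
  rel_symbols :: "'r set"
  const_symbols :: "'c set"
  fun_symbols :: "'f set"
  rel_arity :: "'r \<Rightarrow> nat"
  fun_arity :: "'f \<Rightarrow> nat"

definition countable_language :: "('r, 'c, 'f) language \<Rightarrow> bool" where
  "countable_language L \<longleftrightarrow>
     countable (rel_symbols L) \<and> countable (const_symbols L) \<and> countable (fun_symbols L)"

record ('r, 'c, 'f, 'a) interpretation_data =
  universe :: "'a set"
  rel_of :: "'r \<Rightarrow> 'a list \<Rightarrow> bool"
  const_of :: "'c \<Rightarrow> 'a"
  fun_of :: "'f \<Rightarrow> 'a list \<Rightarrow> 'a"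

definition tuples :: "'a set \<Rightarrow> nat \<Rightarrow> 'a list set" where
  "tuples A n = {xs. set xs \<subseteq> A \<and> length xs = n}"

text \<open>
  Interpretations are fixed to \<open>False\<close> or \<open>undefined\<close> outside their domain, so that two structures
  are equal as HOL values exactly when they agree on the universe and on all symbols of the
  language.
\<close>

definition is_structure ::
  "('r, 'c, 'f) language \<Rightarrow> ('r, 'c, 'f, 'a) interpretation_data \<Rightarrow> bool" where
  "is_structure L M \<longleftrightarrow>
     (\<forall>R xs. rel_of M R xs \<longrightarrow> R \<in> rel_symbols L \<and> xs \<in> tuples (universe M) (rel_arity L R)) \<and>
     (\<forall>c. if c \<in> const_symbols L then const_of M c \<in> universe M else const_of M c = undefined) \<and>
     (\<forall>f xs. if f \<in> fun_symbols L \<and> xs \<in> tuples (universe M) (fun_arity L f)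
             then fun_of M f xs \<in> universe M else fun_of M f xs = undefined)"

definition isomorphism ::
  "('r, 'c, 'f) language \<Rightarrow> ('r, 'c, 'f, 'a) interpretation_data \<Rightarrow>
   ('r, 'c, 'f, 'b) interpretation_data \<Rightarrow> ('a \<Rightarrow> 'b) \<Rightarrow> bool" where
  "isomorphism L M N h \<longleftrightarrow>
     bij_betw h (universe M) (universe N) \<and>
     (\<forall>R\<in>rel_symbols L. \<forall>xs\<in>tuples (universe M) (rel_arity L R).
        rel_of M R xs \<longleftrightarrow> rel_of N R (map h xs)) \<and>
     (\<forall>c\<in>const_symbols L. h (const_of M c) = const_of N c) \<and>
     (\<forall>f\<in>fun_symbols L. \<forall>xs\<in>tuples (universe M) (fun_arity L f).
        h (fun_of M f xs) = fun_of N f (map h xs))"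

definition isomorphic ::
  "('r, 'c, 'f) language \<Rightarrow> ('r, 'c, 'f, 'a) interpretation_data \<Rightarrow>
   ('r, 'c, 'f, 'b) interpretation_data \<Rightarrow> bool" where
  "isomorphic L M N \<longleftrightarrow> (\<exists>h. isomorphism L M N h)"

abbreviation automorphism ::
  "('r, 'c, 'f) language \<Rightarrow> ('r, 'c, 'f, 'a) interpretation_data \<Rightarrow> ('a \<Rightarrow> 'a) \<Rightarrow> bool" where
  "automorphism L M h \<equiv> isomorphism L M M h"

definition definable_closure ::
  "('r, 'c, 'f) language \<Rightarrow> ('r, 'c, 'f, 'a) interpretation_data \<Rightarrow> 'a list \<Rightarrow> 'a set" where
  "definable_closure L M as =
     {b \<in> universe M. \<forall>h. automorphism L M h \<and> (\<forall>a\<in>set as. h a = a) \<longrightarrow> h b = b}"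

definition trivial_definable_closure ::
  "('r, 'c, 'f) language \<Rightarrow> ('r, 'c, 'f, 'a) interpretation_data \<Rightarrow> bool" where
  "trivial_definable_closure L M \<longleftrightarrow>
     (\<forall>as. set as \<subseteq> universe M \<longrightarrow> definable_closure L M as = set as)"

definition nat_structures ::
  "('r, 'c, 'f) language \<Rightarrow> ('r, 'c, 'f, nat) interpretation_data set" where
  "nat_structures L = {N. is_structure L N \<and> universe N = UNIV}"

definition structure_space ::
  "('r, 'c, 'f) language \<Rightarrow> ('r, 'c, 'f, nat) interpretation_data measure" where
  "structure_space L = sigma (nat_structures L)
     ({{N \<in> nat_structures L. rel_of N R ns} | R ns.
         R \<in> rel_symbols L \<and> ns \<in> tuples UNIV (rel_arity L R)} \<union>
      {{N \<in> nat_structures L. const_of N c = l} | c l. c \<in> const_symbols L} \<union>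
      {{N \<in> nat_structures L. fun_of N f ns = l} | f ns l.
         f \<in> fun_symbols L \<and> ns \<in> tuples UNIV (fun_arity L f)})"

text \<open>
  The structure obtained by transporting \<open>N\<close> along the permutation \<open>g\<close>, so that \<open>g\<close> is an
  isomorphism from \<open>N\<close> to its image. The conditionals keep it extensional.
\<close>

definition logic_action ::
  "('r, 'c, 'f) language \<Rightarrow> (nat \<Rightarrow> nat) \<Rightarrow> ('r, 'c, 'f, nat) interpretation_data \<Rightarrow>
   ('r, 'c, 'f, nat) interpretation_data" where
  "logic_action L g N =
     \<lparr>universe = UNIV,
      rel_of = (\<lambda>R ns. rel_of N R (map (inv g) ns)),
      const_of = (\<lambda>c. if c \<in> const_symbols L then g (const_of N c) else undefined),
      fun_of = (\<lambda>f ns. if f \<in> fun_symbols L \<and> ns \<in> tuples UNIV (fun_arity L f)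
                       then g (fun_of N f (map (inv g) ns)) else undefined)\<rparr>"

definition invariant_measure ::
  "('r, 'c, 'f) language \<Rightarrow> ('r, 'c, 'f, nat) interpretation_data measure \<Rightarrow> bool" where
  "invariant_measure L \<mu> \<longleftrightarrow>
     (\<forall>g. bij g \<longrightarrow> (\<forall>A\<in>sets \<mu>. emeasure \<mu> (logic_action L g ` A) = emeasure \<mu> A))"

text \<open>
  Since \<open>emeasure\<close> is \<open>0\<close> on non-measurable sets, this includes measurability of the isomorphism
  class.
\<close>

definition concentrated_on ::
  "('r, 'c, 'f) language \<Rightarrow> ('r, 'c, 'f, nat) interpretation_data measure \<Rightarrow>
   ('r, 'c, 'f, 'a) interpretation_data \<Rightarrow> bool" where
  "concentrated_on L \<mu> M \<longleftrightarrow> emeasure \<mu> {N \<in> nat_structures L. isomorphic L N M} = 1"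

end

theory Submission
  imports Defs
begin

text \<open>
  Trivial definable closure yields a sequence \<open>e 1, e 2, \<dots>\<close> of distinct elements of \<open>M\<close> in which each
  new element is either free or a duplicate of an earlier one, its parent, having the same type over
  all the other earlier elements; every element gets infinitely many duplicates, and every one-point
  extension of every tuple is eventually witnessed by a free element. Flipping a coin at each new
  duplicate of the current element (whether to move there) turns the sequence into a random walk. For
  infinitely many independent walks, the type of the tuple of current positions never changes once the
  positions are distinct, and by back-and-forth the limiting types almost surely describe a structure
  on the natural numbers that is isomorphic to \<open>M\<close>. Its law is invariant because the walks are
  independent and identically distributed. That the isomorphism class is Borel at all follows by a
  version of Scott's argument without ordinals: tuples of \<open>M\<close> that cannot be distinguished by
  invariant Borel predicates already have the back-and-forth property.
\<close>

section \<open>Back and forth\<close>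

text \<open>The obstacle is that a countable structure carries no atomless distribution from which
  to draw infinitely many distinct points. If all elements were free, two walks would enter at the
  same element with positive probability and stay together forever. Duplicates remove this: a shared
  position is split again and again, and trivial definable closure is what supplies a fresh
  duplicate at every stage. The price is that positions need not converge; only the orbits of finite
  tuples of positions do. So the limit is a bijection onto \<open>M\<close> known only up to
  automorphisms, and it is picked without any regard to measurability. What is measurable is every
  automorphism-invariant predicate of it, and the structure pulled back along it depends on nothing
  else. Free elements serve surjectivity. A witness for a one-point extension helps only if it
  appears before the walks of the given tuple move again, so the witnesses for all tuples of bounded
  indices come in one uninterrupted run of free steps. Index \<open>0\<close> means both "no parent"
  and "nothing chosen yet", so that one rule covers entering and moving.\<close>

lemma back_and_forth:
  fixes T :: "('a::countable \<times> 'b::countable) list \<Rightarrow> bool"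
  assumes Nil: "T []"
    and forth: "\<And>zs a. T zs \<Longrightarrow> a \<notin> fst ` set zs \<Longrightarrow> \<exists>b. T ((a, b) # zs)"
    and backward: "\<And>zs b. T zs \<Longrightarrow> b \<notin> snd ` set zs \<Longrightarrow> \<exists>a. T ((a, b) # zs)"
    and inj: "\<And>zs a b a' b'. T zs \<Longrightarrow> (a, b) \<in> set zs \<Longrightarrow> (a', b') \<in> set zs \<Longrightarrow> a = a' \<longleftrightarrow> b = b'"
  obtains h where "bij h"
    and "\<And>F. finite F \<Longrightarrow> \<exists>zs. T zs \<and> (\<forall>a\<in>F. (a, h a) \<in> set zs)"
proof -
  have step: "\<exists>zs'. T zs' \<and> set zs \<subseteq> set zs' \<and> a \<in> fst ` set zs' \<and> b \<in> snd ` set zs'"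
    if T: "T zs" for zs a b
  proof -
    obtain zs1 where 1: "T zs1" "set zs \<subseteq> set zs1" "a \<in> fst ` set zs1"
    proof (cases "a \<in> fst ` set zs")
      case False
      then obtain c where "T ((a, c) # zs)" using forth T by blast
      then show ?thesis by (intro that[of "(a, c) # zs"]) auto
    qed (use T that in blast)
    show ?thesis
    proof (cases "b \<in> snd ` set zs1")
      case False
      then obtain c where "T ((c, b) # zs1)" using backward 1 by blast
      then show ?thesis using 1 by (intro exI[of _ "(c, b) # zs1"]) auto
    qed (use 1 in blast)
  qed
  obtain Z where Z: "\<And>k::nat. T (Z k)"
    and Zs: "\<And>k. set (Z k) \<subseteq> set (Z (Suc k)) \<and> from_nat k \<in> fst ` set (Z (Suc k)) \<and>
      from_nat k \<in> snd ` set (Z (Suc k))"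
    using dependent_nat_choice[of "\<lambda>_ zs. T zs" "\<lambda>k zs zs'. set zs \<subseteq> set zs' \<and>
      from_nat k \<in> fst ` set zs' \<and> from_nat k \<in> snd ` set zs'"] Nil step by metis
  have mono: "set (Z i) \<subseteq> set (Z j)" if "i \<le> j" for i j
    using lift_Suc_mono_le[of "\<lambda>k. set (Z k)"] Zs that by blast
  \<comment> \<open>\<open>inj\<close> speaks about a single list, so pairs from two stages are
    compared at the later stage.\<close>
  have R: "a = a' \<longleftrightarrow> b = b'" if "(a, b) \<in> set (Z i)" "(a', b') \<in> set (Z j)" for a b a' b' i j
    using inj[OF Z[of "max i j"], of a b a' b'] that mono[of i "max i j"] mono[of j "max i j"] by auto
  have "\<exists>b k. (a, b) \<in> set (Z k)" for a
    using Zs[of "to_nat a"] by force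
  then obtain h K where h: "\<And>a. (a, h a) \<in> set (Z (K a))" by metis
  have "\<exists>a k. (a, b) \<in> set (Z k)" for b
    using Zs[of "to_nat b"] by force
  then have "surj h" unfolding surj_def using R h by metis
  moreover have "inj h" by (rule injI) (use R h in metis)
  ultimately have "bij h" by (simp add: bij_def)
  moreover have "\<exists>zs. T zs \<and> (\<forall>a\<in>F. (a, h a) \<in> set zs)" if "finite F" for F
  proof (intro exI conjI ballI)
    show "T (Z (Max (K ` F)))" by (rule Z)
    show "(a, h a) \<in> set (Z (Max (K ` F)))" if "a \<in> F" for a
      using h[of a] mono[of "K a" "Max (K ` F)"] \<open>finite F\<close> that by auto
  qed
  ultimately show thesis by (rule that)
qed

section \<open>Isomorphisms and the logic action\<close>

lemma map_in_tuples: "h ` A \<subseteq> B \<Longrightarrow> xs \<in> tuples A n \<Longrightarrow> map h xs \<in> tuples B n"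
  by (auto simp: tuples_def)

lemma map_in_tuples_UNIV [simp]: "map h xs \<in> tuples UNIV n \<longleftrightarrow> xs \<in> tuples UNIV n"
  by (simp add: tuples_def)

lemma isomorphism_id: "isomorphism L M M id"
  by (simp add: isomorphism_def)

lemma isomorphismD:
  assumes "isomorphism L M N h"
  shows "R \<in> rel_symbols L \<Longrightarrow> xs \<in> tuples (universe M) (rel_arity L R) \<Longrightarrow>
      rel_of M R xs \<longleftrightarrow> rel_of N R (map h xs)"
    and "c \<in> const_symbols L \<Longrightarrow> h (const_of M c) = const_of N c"
    and "f \<in> fun_symbols L \<Longrightarrow> ys \<in> tuples (universe M) (fun_arity L f) \<Longrightarrow>
      h (fun_of M f ys) = fun_of N f (map h ys)"
proof -
  note * = assms[unfolded isomorphism_def, THEN conjunct2]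
  show "R \<in> rel_symbols L \<Longrightarrow> xs \<in> tuples (universe M) (rel_arity L R) \<Longrightarrow>
      rel_of M R xs \<longleftrightarrow> rel_of N R (map h xs)"
    by (rule *[THEN conjunct1, rule_format])
  show "c \<in> const_symbols L \<Longrightarrow> h (const_of M c) = const_of N c"
    by (rule *[THEN conjunct2, THEN conjunct1, rule_format])
  show "f \<in> fun_symbols L \<Longrightarrow> ys \<in> tuples (universe M) (fun_arity L f) \<Longrightarrow>
      h (fun_of M f ys) = fun_of N f (map h ys)"
    by (rule *[THEN conjunct2, THEN conjunct2, rule_format])
qed

lemma isomorphism_comp:
  assumes h: "isomorphism L M N h" and k: "isomorphism L N K k"
  shows "isomorphism L M K (k \<circ> h)"
proof -
  have "map h xs \<in> tuples (universe N) n" if "xs \<in> tuples (universe M) n" for xs n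
    using h that by (intro map_in_tuples) (auto simp: isomorphism_def bij_betw_def)
  then show ?thesis
    using h k bij_betw_trans unfolding isomorphism_def by (fastforce simp flip: map_map)
qed

lemma isomorphism_inv_into:
  assumes M: "is_structure L M" and h: "isomorphism L M N h"
  shows "isomorphism L N M (inv_into (universe M) h)"
proof -
  let ?k = "inv_into (universe M) h"
  have b: "bij_betw h (universe M) (universe N)" using h by (simp add: isomorphism_def)
  then have bk: "bij_betw ?k (universe N) (universe M)" by (rule bij_betw_inv_into)
  have kh: "?k (h x) = x" if "x \<in> universe M" for x
    using b that by (simp add: bij_betw_inv_into_left)
  have t: "map ?k xs \<in> tuples (universe M) n" if "xs \<in> tuples (universe N) n" for xs n
    using bk that by (intro map_in_tuples) (auto simp: bij_betw_def)
  have hk: "map h (map ?k xs) = xs" if "xs \<in> tuples (universe N) n" for xs n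
    using b that by (auto simp: tuples_def bij_betw_inv_into_right intro!: map_idI)
  have "?k (const_of N c) = const_of M c" if "c \<in> const_symbols L" for c
    using M h kh that unfolding isomorphism_def is_structure_def by metis
  moreover have "rel_of N R xs \<longleftrightarrow> rel_of M R (map ?k xs)"
    if "R \<in> rel_symbols L" "xs \<in> tuples (universe N) (rel_arity L R)" for R xs
    using h t[OF that(2)] hk[OF that(2)] that(1) unfolding isomorphism_def by metis
  moreover have "?k (fun_of N f xs) = fun_of M f (map ?k xs)"
    if "f \<in> fun_symbols L" "xs \<in> tuples (universe N) (fun_arity L f)" for f xs
  proof -
    have "fun_of M f (map ?k xs) \<in> universe M"
      using M t[OF that(2)] that(1) unfolding is_structure_def by meson
    moreover have "h (fun_of M f (map ?k xs)) = fun_of N f xs"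
      using h t[OF that(2)] hk[OF that(2)] that(1) unfolding isomorphism_def by metis
    ultimately show ?thesis using kh by metis
  qed
  ultimately show ?thesis using bk by (simp add: isomorphism_def)
qed

lemma isomorphism_bij:
  assumes "M \<in> nat_structures L" "N \<in> nat_structures L" "isomorphism L M N h"
  shows "bij h"
  using assms by (simp add: nat_structures_def isomorphism_def)

lemma logic_action_sel [simp]:
  "universe (logic_action L g N) = UNIV"
  "rel_of (logic_action L g N) R ns = rel_of N R (map (inv g) ns)"
  "c \<in> const_symbols L \<Longrightarrow> const_of (logic_action L g N) c = g (const_of N c)"
  "f \<in> fun_symbols L \<Longrightarrow> ns \<in> tuples UNIV (fun_arity L f) \<Longrightarrow>
    fun_of (logic_action L g N) f ns = g (fun_of N f (map (inv g) ns))"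
  by (simp_all add: logic_action_def)

lemma logic_action_in_nat_structures:
  "N \<in> nat_structures L \<Longrightarrow> logic_action L g N \<in> nat_structures L"
  unfolding nat_structures_def is_structure_def
  by (auto simp: logic_action_def tuples_def) (metis length_map)

lemma map_inv_map [simp]: "bij g \<Longrightarrow> map (inv g) (map g xs) = xs"
  by (simp add: bij_is_inj)

lemma map_map_inv [simp]: "bij g \<Longrightarrow> map g (map (inv g) xs) = xs"
  by (simp add: bij_is_surj surj_f_inv_f map_idI)

lemma isomorphism_logic_action:
  assumes "N \<in> nat_structures L" "bij g"
  shows "isomorphism L N (logic_action L g N) g"
  using assms by (auto simp: isomorphism_def nat_structures_def simp del: map_map)

lemma nat_structures_eqI:
  assumes N: "N \<in> nat_structures L" "N' \<in> nat_structures L"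
    and "\<And>R ns. R \<in> rel_symbols L \<Longrightarrow> ns \<in> tuples UNIV (rel_arity L R) \<Longrightarrow> rel_of N R ns = rel_of N' R ns"
    and "\<And>c. c \<in> const_symbols L \<Longrightarrow> const_of N c = const_of N' c"
    and "\<And>f ns. f \<in> fun_symbols L \<Longrightarrow> ns \<in> tuples UNIV (fun_arity L f) \<Longrightarrow> fun_of N f ns = fun_of N' f ns"
  shows "N = N'"
proof -
  have "rel_of N R ns = rel_of N' R ns" for R ns
    using N assms(3)[of R ns] unfolding nat_structures_def is_structure_def by force
  moreover have "const_of N c = const_of N' c" for c
    using N assms(4)[of c] unfolding nat_structures_def is_structure_def by simp metis
  moreover have "fun_of N f ns = fun_of N' f ns" for f ns
    using N assms(5)[of f ns] unfolding nat_structures_def is_structure_def by simp metis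
  ultimately show ?thesis
    using N by (intro interpretation_data.equality) (auto simp: nat_structures_def fun_eq_iff)
qed

text \<open>Structures are extensional, so an isomorphism determines its target as a HOL value.
  Isomorphism classes within \<open>nat_structures L\<close> are therefore orbits of the logic
  action.\<close>

lemma isomorphism_eq_logic_action:
  assumes N: "N \<in> nat_structures L" "N' \<in> nat_structures L" and g: "isomorphism L N N' g"
  shows "N' = logic_action L g N"
proof (rule nat_structures_eqI[OF N(2) logic_action_in_nat_structures[OF N(1)]])
  note b = isomorphism_bij[OF N g]
  have u: "universe N = UNIV" using N by (simp add: nat_structures_def)
  show "rel_of N' R ns = rel_of (logic_action L g N) R ns"
    if "R \<in> rel_symbols L" "ns \<in> tuples UNIV (rel_arity L R)" for R ns
    using g b that unfolding isomorphism_def u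
    by (metis logic_action_sel(2) map_in_tuples_UNIV map_map_inv)
  show "const_of N' c = const_of (logic_action L g N) c" if "c \<in> const_symbols L" for c
    using g that by (simp add: isomorphism_def)
  show "fun_of N' f ns = fun_of (logic_action L g N) f ns"
    if "f \<in> fun_symbols L" "ns \<in> tuples UNIV (fun_arity L f)" for f ns
    using g b that unfolding isomorphism_def u
    by (metis logic_action_sel(4) map_in_tuples_UNIV map_map_inv)
qed

lemma logic_action_comp:
  assumes "N \<in> nat_structures L" "bij g" "bij k"
  shows "logic_action L g (logic_action L k N) = logic_action L (g \<circ> k) N"
proof (rule isomorphism_eq_logic_action)
  show "isomorphism L N (logic_action L g (logic_action L k N)) (g \<circ> k)"
    by (rule isomorphism_comp[OF isomorphism_logic_action isomorphism_logic_action])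
      (use assms in \<open>auto intro: logic_action_in_nat_structures\<close>)
qed (use assms in \<open>auto intro: logic_action_in_nat_structures\<close>)

lemma logic_action_id: "N \<in> nat_structures L \<Longrightarrow> logic_action L id N = N"
  using isomorphism_eq_logic_action[OF _ _ isomorphism_id] by metis

lemma logic_action_inv:
  assumes "N \<in> nat_structures L" "bij g"
  shows "logic_action L (inv g) (logic_action L g N) = N"
    and "logic_action L g (logic_action L (inv g) N) = N"
  using assms by (simp_all add: logic_action_comp bij_imp_bij_inv logic_action_id bij_is_inj
      bij_is_surj surj_iff[THEN iffD1])

text \<open>Invariance is phrased with images, measurability with preimages; passing to the inverse
  permutation translates one into the other.\<close>

lemma logic_action_image:
  assumes "A \<subseteq> nat_structures L" "bij g"
  shows "logic_action L g ` A = logic_action L (inv g) -` A \<inter> nat_structures L"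
proof -
  have "N \<in> logic_action L g ` A" if "logic_action L (inv g) N \<in> A" "N \<in> nat_structures L" for N
    using logic_action_inv(2)[OF that(2) assms(2)] that(1) by (metis imageI)
  then show ?thesis
    using assms logic_action_inv(1) logic_action_in_nat_structures by fastforce
qed

section \<open>Isomorphism classes are Borel\<close>

lemma structure_space_generators:
  "{{N \<in> nat_structures L. rel_of N R ns} | R ns.
         R \<in> rel_symbols L \<and> ns \<in> tuples UNIV (rel_arity L R)} \<union>
      {{N \<in> nat_structures L. const_of N c = l} | c l. c \<in> const_symbols L} \<union>
      {{N \<in> nat_structures L. fun_of N f ns = l} | f ns l.
         f \<in> fun_symbols L \<and> ns \<in> tuples UNIV (fun_arity L f)} \<subseteq> Pow (nat_structures L)"
  by auto

lemma space_structure_space [simp]: "space (structure_space L) = nat_structures L"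
  unfolding structure_space_def by (rule space_measure_of[OF structure_space_generators])

lemma
  shows pred_rel_of: "R \<in> rel_symbols L \<Longrightarrow> ns \<in> tuples UNIV (rel_arity L R) \<Longrightarrow>
      Measurable.pred (structure_space L) (\<lambda>N. rel_of N R ns)"
    and pred_const_of: "c \<in> const_symbols L \<Longrightarrow>
      Measurable.pred (structure_space L) (\<lambda>N. const_of N c = l)"
    and pred_fun_of: "f \<in> fun_symbols L \<Longrightarrow> ns \<in> tuples UNIV (fun_arity L f) \<Longrightarrow>
      Measurable.pred (structure_space L) (\<lambda>N. fun_of N f ns = l)"
  unfolding pred_def space_structure_space
  unfolding structure_space_def sets_measure_of[OF structure_space_generators]
  by (rule sigma_sets.Basic; blast)+

lemma measurable_structure_space:
  assumes space: "\<And>x. x \<in> space P \<Longrightarrow> F x \<in> nat_structures L"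
    and "\<And>R ns. R \<in> rel_symbols L \<Longrightarrow> ns \<in> tuples UNIV (rel_arity L R) \<Longrightarrow>
      Measurable.pred P (\<lambda>x. rel_of (F x) R ns)"
    and "\<And>c l. c \<in> const_symbols L \<Longrightarrow> Measurable.pred P (\<lambda>x. const_of (F x) c = l)"
    and "\<And>f ns l. f \<in> fun_symbols L \<Longrightarrow> ns \<in> tuples UNIV (fun_arity L f) \<Longrightarrow>
      Measurable.pred P (\<lambda>x. fun_of (F x) f ns = l)"
  shows "F \<in> P \<rightarrow>\<^sub>M structure_space L"
  unfolding structure_space_def
proof (rule measurable_measure_of[OF structure_space_generators])
  have *: "F -` {N \<in> nat_structures L. Q N} \<inter> space P = {x \<in> space P. Q (F x)}" for Q
    using space by auto
  show "F -` A \<inter> space P \<in> sets P" if "A \<in> {{N \<in> nat_structures L. rel_of N R ns} | R ns.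
         R \<in> rel_symbols L \<and> ns \<in> tuples UNIV (rel_arity L R)} \<union>
      {{N \<in> nat_structures L. const_of N c = l} | c l. c \<in> const_symbols L} \<union>
      {{N \<in> nat_structures L. fun_of N f ns = l} | f ns l.
         f \<in> fun_symbols L \<and> ns \<in> tuples UNIV (fun_arity L f)}" for A
    using that assms(2-)[unfolded pred_def] by (elim UnE CollectE exE conjE) (simp_all only: *)
qed (use space in auto)

lemma measurable_logic_action:
  assumes g: "bij g"
  shows "logic_action L g \<in> structure_space L \<rightarrow>\<^sub>M structure_space L"
proof (rule measurable_structure_space)
  have *: "g x = l \<longleftrightarrow> x = inv g l" for x l
    using g by (auto simp: bij_is_inj bij_is_surj surj_f_inv_f)
  show "Measurable.pred (structure_space L) (\<lambda>N. const_of (logic_action L g N) c = l)"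
    if "c \<in> const_symbols L" for c l
    using that by (simp add: * pred_const_of)
  show "Measurable.pred (structure_space L) (\<lambda>N. fun_of (logic_action L g N) f ns = l)"
    if "f \<in> fun_symbols L" "ns \<in> tuples UNIV (fun_arity L f)" for f ns l
    using that by (simp add: * pred_fun_of)
qed (auto simp: logic_action_in_nat_structures intro: pred_rel_of)

text \<open>The semantic counterpart of \<open>L\<^sub>\<omega>\<^sub>1\<^sub>\<omega>\<close>-formulas.\<close>

definition invariant_formula ::
  "('r, 'c, 'f) language \<Rightarrow> (('r, 'c, 'f, nat) interpretation_data \<Rightarrow> nat list \<Rightarrow> bool) \<Rightarrow> bool" where
  "invariant_formula L S \<longleftrightarrow>
     (\<forall>xs. Measurable.pred (structure_space L) (\<lambda>N. S N xs)) \<and>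
     (\<forall>g N xs. bij g \<longrightarrow> N \<in> nat_structures L \<longrightarrow> S (logic_action L g N) (map g xs) = S N xs)"

lemma invariant_formula_not: "invariant_formula L S \<Longrightarrow> invariant_formula L (\<lambda>N xs. \<not> S N xs)"
  by (auto simp: invariant_formula_def intro: pred_intros_logic)

lemma invariant_formula_all:
  "(\<And>i::'i::countable. invariant_formula L (S i)) \<Longrightarrow> invariant_formula L (\<lambda>N xs. \<forall>i. S i N xs)"
  by (auto simp: invariant_formula_def intro: pred_intros_countable)

text \<open>A permutation is onto, so a witness in the transported structure has the form
  \<open>g z\<close>. The quantifier ranges over a countable universe, which keeps the predicate
  Borel.\<close>

lemma invariant_formula_ex:
  assumes S: "invariant_formula L S"
  shows "invariant_formula L (\<lambda>N xs. \<exists>y. S N (y # xs))"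
proof -
  have "(\<exists>y. S (logic_action L g N) (y # map g xs)) \<longleftrightarrow> (\<exists>y. S N (y # xs))"
    if g: "bij g" and N: "N \<in> nat_structures L" for g N xs
  proof -
    have "(\<exists>y. S (logic_action L g N) (y # map g xs)) \<longleftrightarrow> (\<exists>z. S (logic_action L g N) (g z # map g xs))"
      using g by (metis bij_pointE)
    also have "\<dots> \<longleftrightarrow> (\<exists>z. S (logic_action L g N) (map g (z # xs)))" by simp
    also have "\<dots> \<longleftrightarrow> (\<exists>z. S N (z # xs))" using S g N by (simp only: invariant_formula_def)
    finally show ?thesis .
  qed
  then show ?thesis using S by (auto simp: invariant_formula_def intro: pred_intros_countable)
qed

text \<open>Atomic formulas whose variables are positions in a tuple. The bounds on positions belong
  to the formulas because \<open>xs ! i\<close> beyond the length need not commute with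
  \<open>map g\<close>, and invariance would be lost.\<close>

inductive index_formula ::
  "('r, 'c, 'f) language \<Rightarrow> (('r, 'c, 'f, nat) interpretation_data \<Rightarrow> nat list \<Rightarrow> bool) \<Rightarrow> bool"
  for L where
  eq: "index_formula L (\<lambda>N xs. i < length xs \<and> j < length xs \<and> xs ! i = xs ! j)"
| rel: "R \<in> rel_symbols L \<Longrightarrow> index_formula L
    (\<lambda>N xs. is \<in> tuples {..<length xs} (rel_arity L R) \<and> rel_of N R (map ((!) xs) is))"
| const: "c \<in> const_symbols L \<Longrightarrow> index_formula L
    (\<lambda>N xs. j < length xs \<and> const_of N c = xs ! j)"
| func: "f \<in> fun_symbols L \<Longrightarrow> index_formula L
    (\<lambda>N xs. is \<in> tuples {..<length xs} (fun_arity L f) \<and> j < length xs \<and>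
       fun_of N f (map ((!) xs) is) = xs ! j)"

lemma countable_index_formula:
  fixes L :: "('r, 'c, 'f) language"
  assumes "countable_language L"
  shows "countable {S. index_formula L S}"
proof (rule countable_subset)
  let ?B = "range (\<lambda>(i, j) (N :: ('r, 'c, 'f, nat) interpretation_data) (xs :: nat list).
    i < length xs \<and> j < length xs \<and> xs ! i = xs ! j)"
  let ?C = "(\<lambda>(R, is) N xs. is \<in> tuples {..<length xs} (rel_arity L R) \<and> rel_of N R (map ((!) xs) is)) `
    (rel_symbols L \<times> UNIV)"
  let ?D = "(\<lambda>(c, j) N xs. j < length xs \<and> const_of N c = xs ! j) ` (const_symbols L \<times> UNIV)"
  let ?E = "(\<lambda>(f, is, j) N xs. is \<in> tuples {..<length xs} (fun_arity L f) \<and> j < length xs \<and>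
    fun_of N f (map ((!) xs) is) = xs ! j) ` (fun_symbols L \<times> UNIV)"
  show "countable (?B \<union> ?C \<union> ?D \<union> ?E)"
    using assms by (simp add: countable_language_def)
  show "{S. index_formula L S} \<subseteq> ?B \<union> ?C \<union> ?D \<union> ?E"
  proof
    fix S assume "S \<in> {S. index_formula L S}"
    then have "index_formula L S" by simp
    then show "S \<in> ?B \<union> ?C \<union> ?D \<union> ?E"
    proof (cases rule: index_formula.cases)
      case (eq i j)
      then have "S \<in> ?B" by (intro image_eqI[where x = "(i, j)"]) simp_all
      then show ?thesis by (simp only: Un_iff simp_thms)
    next
      case (rel R "is")
      then have "S \<in> ?C" by (intro image_eqI[where x = "(R, is)"]) simp_all
      then show ?thesis by (simp only: Un_iff simp_thms)
    next
      case (const c j)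
      then have "S \<in> ?D" by (intro image_eqI[where x = "(c, j)"]) simp_all
      then show ?thesis by (simp only: Un_iff simp_thms)
    next
      case (func f "is" j)
      then have "S \<in> ?E" by (intro image_eqI[where x = "(f, is, j)"]) simp_all
      then show ?thesis by (simp only: Un_iff simp_thms)
    qed
  qed
qed

lemma map_nth_map: "is \<in> tuples {..<length xs} n \<Longrightarrow> map ((!) (map g xs)) is = map g (map ((!) xs) is)"
  by (auto simp: tuples_def)

lemma index_formula_invariant:
  assumes "index_formula L S"
  shows "invariant_formula L S"
proof -
  have tup: "map ((!) xs) is \<in> tuples UNIV n" if "is \<in> tuples {..<length xs} n"
    for xs :: "nat list" and "is" n
    using that by (simp add: tuples_def)
  have fin: "Measurable.pred (structure_space L) (\<lambda>N. P \<and> Q N)"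
    if "P \<Longrightarrow> Measurable.pred (structure_space L) (\<lambda>N. Q N)" for P Q
    using that by (cases P) simp_all
  have inj: "g x = g y \<longleftrightarrow> x = y" if "bij g" for g :: "nat \<Rightarrow> nat" and x y
    using that by (auto dest: bij_is_inj injD)
  have meas: "invariant_formula L S"
    if "\<And>xs. Measurable.pred (structure_space L) (\<lambda>N. S N xs)"
      and "\<And>g N xs. bij g \<Longrightarrow> S (logic_action L g N) (map g xs) = S N xs"
    using that by (simp add: invariant_formula_def)
  from assms show ?thesis
  proof (cases rule: index_formula.cases)
    case (eq i j)
    show ?thesis
    proof (rule meas)
      show "S (logic_action L g N) (map g xs) = S N xs" if "bij g" for g N xs
        unfolding eq by (auto simp: inj[OF that])
    qed (simp add: eq)
  next
    case (rel R "is")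
    show ?thesis
    proof (rule meas)
      show "Measurable.pred (structure_space L) (\<lambda>N. S N xs)" for xs
        unfolding rel(1) by (intro fin pred_rel_of rel(2) tup)
      show "S (logic_action L g N) (map g xs) = S N xs" if "bij g" for g N xs
        using that unfolding rel(1) by (simp add: map_nth_map del: map_map cong: conj_cong)
    qed
  next
    case (const c j)
    show ?thesis
    proof (rule meas)
      show "Measurable.pred (structure_space L) (\<lambda>N. S N xs)" for xs
        unfolding const(1) by (intro fin pred_const_of const(2))
      show "S (logic_action L g N) (map g xs) = S N xs" if "bij g" for g N xs
        using const(2) unfolding const(1) by (auto simp: inj[OF that])
    qed
  next
    case (func f "is" j)
    show ?thesis
    proof (rule meas)
      show "Measurable.pred (structure_space L) (\<lambda>N. S N xs)" for xs
        unfolding func(1) by (intro fin pred_fun_of func(2) tup)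
      show "S (logic_action L g N) (map g xs) = S N xs" if "bij g" for g N xs
      proof (cases "is \<in> tuples {..<length xs} (fun_arity L f)")
        case True
        then have "is \<in> tuples UNIV (fun_arity L f)" by (simp add: tuples_def)
        then show ?thesis
          using True that func(2) unfolding func(1)
          by (auto simp: map_nth_map inj[OF that] simp del: map_map)
      qed (simp add: func(1))
    qed
  qed
qed

text \<open>A list supplied for \<open>F\<close> may contain further pairs in any order;
  \<open>is\<close> selects the positions that spell out the required arguments. For constants and
  functions, \<open>F\<close> also contains the value, so that it too has a position.\<close>

lemma isomorphismI_index_formula:
  assumes N: "N \<in> nat_structures L" "M \<in> nat_structures L" and h: "bij h"
    and agree: "\<And>F. finite F \<Longrightarrow> \<exists>zs. (\<forall>S. index_formula L S \<longrightarrow> S N (map fst zs) = S M (map snd zs)) \<and>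
      (\<forall>a\<in>F. (a, h a) \<in> set zs)"
  shows "isomorphism L N M h"
proof -
  have u: "universe N = UNIV" "universe M = UNIV" using N by (simp_all add: nat_structures_def)
  have ag: "\<exists>zs is. (\<forall>S. index_formula L S \<longrightarrow> S N (map fst zs) = S M (map snd zs)) \<and>
      is \<in> tuples {..<length zs} (length xs) \<and>
      map ((!) (map fst zs)) is = xs \<and> map ((!) (map snd zs)) is = map h xs" for xs
  proof -
    obtain zs where zs: "\<forall>S. index_formula L S \<longrightarrow> S N (map fst zs) = S M (map snd zs)"
      "\<forall>a\<in>set xs. (a, h a) \<in> set zs" using agree[of "set xs"] by auto
    then have "\<forall>a\<in>set xs. \<exists>i<length zs. zs ! i = (a, h a)" by (simp add: in_set_conv_nth)
    then obtain I where "\<And>a. a \<in> set xs \<Longrightarrow> I a < length zs \<and> zs ! I a = (a, h a)" by metis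
    then show ?thesis using zs(1)
      by (intro exI[of _ zs] exI[of _ "map I xs"]) (auto simp: tuples_def intro!: map_idI)
  qed
  have "rel_of N R xs \<longleftrightarrow> rel_of M R (map h xs)"
    if R: "R \<in> rel_symbols L" "xs \<in> tuples UNIV (rel_arity L R)" for R xs
  proof -
    obtain zs "is" where *: "\<forall>S. index_formula L S \<longrightarrow> S N (map fst zs) = S M (map snd zs)"
      "is \<in> tuples {..<length zs} (length xs)" "map ((!) (map fst zs)) is = xs"
      "map ((!) (map snd zs)) is = map h xs" using ag by blast
    have "index_formula L (\<lambda>N xs. is \<in> tuples {..<length xs} (rel_arity L R) \<and> rel_of N R (map ((!) xs) is))" by (rule index_formula.rel[OF R(1)])
    from *(1)[rule_format, OF this] *(2-) R(2) show ?thesis by (simp add: tuples_def)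
  qed
  moreover have "h (const_of N c) = const_of M c" if c: "c \<in> const_symbols L" for c
  proof -
    obtain zs "is" where *: "\<forall>S. index_formula L S \<longrightarrow> S N (map fst zs) = S M (map snd zs)"
      "is \<in> tuples {..<length zs} (length [const_of N c])"
      "map ((!) (map fst zs)) is = [const_of N c]"
      "map ((!) (map snd zs)) is = map h [const_of N c]" using ag by blast
    then obtain j where j: "is = [j]" "j < length zs" by (auto simp: tuples_def length_Suc_conv)
    have "index_formula L (\<lambda>N xs. j < length xs \<and> const_of N c = xs ! j)"
      by (rule index_formula.const[OF c])
    from *(1)[rule_format, OF this] *(2-) j show ?thesis by (simp add: tuples_def)
  qed
  moreover have "h (fun_of N f xs) = fun_of M f (map h xs)"
    if f: "f \<in> fun_symbols L" "xs \<in> tuples UNIV (fun_arity L f)" for f xs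
  proof -
    obtain zs js where *: "\<forall>S. index_formula L S \<longrightarrow> S N (map fst zs) = S M (map snd zs)"
      "js \<in> tuples {..<length zs} (length (fun_of N f xs # xs))"
      "map ((!) (map fst zs)) js = fun_of N f xs # xs"
      "map ((!) (map snd zs)) js = map h (fun_of N f xs # xs)" using ag by blast
    then obtain j "is" where j: "js = j # is" "j < length zs" by (auto simp: tuples_def length_Suc_conv)
    have "index_formula L (\<lambda>N xs. is \<in> tuples {..<length xs} (fun_arity L f) \<and> j < length xs \<and>
           fun_of N f (map ((!) xs) is) = xs ! j)"
      by (rule index_formula.func[OF f(1)])
    from *(1)[rule_format, OF this] *(2-) f(2) j show ?thesis by (auto simp: tuples_def)
  qed
  ultimately show ?thesis using h by (simp add: isomorphism_def u)
qed

lemma sets_isomorphism_class: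
  fixes L :: "('r, 'c, 'f) language"
  assumes L: "countable_language L" and M: "M \<in> nat_structures L"
  shows "{N \<in> nat_structures L. isomorphic L N M} \<in> sets (structure_space L)"
proof -
  define eqv where "eqv a b \<longleftrightarrow> (\<forall>S. invariant_formula L S \<longrightarrow> S M a = S M b)" for a b
  have "\<forall>a b. \<exists>S. invariant_formula L S \<and> S M a \<and> (S M b \<longrightarrow> eqv a b)"
  proof (intro allI)
    fix a b
    show "\<exists>S. invariant_formula L S \<and> S M a \<and> (S M b \<longrightarrow> eqv a b)"
    proof (cases "eqv a b")
      case True
      then show ?thesis by (intro exI[of _ "\<lambda>_ _. True"]) (simp add: invariant_formula_def)
    next
      case False
      then obtain S where S: "invariant_formula L S" "S M a \<noteq> S M b" by (auto simp: eqv_def)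
      show ?thesis
      proof (cases "S M a")
        case True
        then show ?thesis using S by (intro exI[of _ S]) simp
      next
        case False
        then show ?thesis
          using S invariant_formula_not[OF S(1)] by (intro exI[of _ "\<lambda>N xs. \<not> S N xs"]) simp
      qed
    qed
  qed
  then obtain S where S: "\<And>a b. invariant_formula L (S a b)" "\<And>a b. S a b M a"
    "\<And>a b. S a b M b \<Longrightarrow> eqv a b"
    unfolding choice_iff by blast
  \<comment> \<open>There are only countably many tuples \<open>b\<close>, so one separating
    predicate for each suffices: in \<open>M\<close>, \<open>\<theta> a\<close> defines exactly the
    \<open>eqv\<close>-class of \<open>a\<close>. It plays the role of the Scott formula of
    \<open>a\<close>.\<close>
  define \<theta> where "\<theta> a N x \<longleftrightarrow> (\<forall>b. S a b N x)" for a N x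
  have \<theta>: "invariant_formula L (\<theta> a)" for a
    unfolding \<theta>_def by (intro invariant_formula_all S)
  have \<theta>M: "\<theta> a M x \<longleftrightarrow> eqv a x" for a x
  proof
    assume e: "eqv a x"
    have "S a b M x" for b
      using e[unfolded eqv_def, rule_format, OF S(1), of a b] S(2) by simp
    then show "\<theta> a M x" by (simp add: \<theta>_def)
  next
    assume "\<theta> a M x"
    then have "S a x M x" by (simp add: \<theta>_def)
    then show "eqv a x" by (rule S(3))
  qed
  have eqv_sym: "eqv a x \<Longrightarrow> eqv x a" and eqv_refl: "eqv a a" for a x by (auto simp: eqv_def)
  \<comment> \<open>"Some \<open>c\<close> extends the tuple to one in the class of
    \<open>y # x\<close>" is itself an invariant formula. It holds at \<open>x\<close>, hence at
    \<open>a\<close>; this closure property replaces the induction on ordinals.\<close>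
  have eqv_ext: "\<exists>c. eqv (y # x) (c # a)" if "eqv a x" for a x y
  proof -
    have "invariant_formula L (\<lambda>N z. \<exists>c. \<theta> (y # x) N (c # z))"
      by (intro invariant_formula_ex \<theta>)
    moreover have "\<exists>c. \<theta> (y # x) M (c # x)"
      unfolding \<theta>M by (rule exI[of _ y]) (rule eqv_refl)
    ultimately have "\<exists>c. \<theta> (y # x) M (c # a)"
      using that[unfolded eqv_def, rule_format, of "\<lambda>N z. \<exists>c. \<theta> (y # x) N (c # z)"] by simp
    then show ?thesis unfolding \<theta>M .
  qed
  \<comment> \<open>Only atomic formulas are compared, because there are countably many of them and
    the comparison must be Borel in \<open>N\<close>. Comparing all invariant formulas would not
    give a countable intersection.\<close>
  define agree where "agree N x a \<longleftrightarrow> (\<forall>S\<in>{S. index_formula L S}. S N x = S M a)" for N x a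
  \<comment> \<open>The Scott sentence of \<open>M\<close>. All quantifiers range over numbers or
    lists of numbers, hence it is a Borel condition on \<open>N\<close>.\<close>
  define sent where "sent N \<longleftrightarrow> \<theta> [] N [] \<and> (\<forall>a x. \<theta> a N x \<longrightarrow>
      (\<forall>y. \<exists>c. \<theta> (c # a) N (y # x)) \<and> (\<forall>c. \<exists>y. \<theta> (c # a) N (y # x)) \<and> agree N x a)" for N
  have agreeM: "agree M x a" if "eqv a x" for a x
    unfolding agree_def
  proof
    fix S assume "S \<in> {S. index_formula L S}"
    then have "invariant_formula L S" by (simp add: index_formula_invariant)
    with that[unfolded eqv_def] show "S M x = S M a" by blast
  qed
  have sentM: "sent M"
    unfolding sent_def \<theta>M using eqv_refl eqv_ext agreeM eqv_sym by meson
  have sentN: "sent (logic_action L g M)" if g: "bij g" for g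
  proof -
    let ?N = "logic_action L g M"
    have t: "\<theta> a ?N (map g x) = \<theta> a M x" for a x
      using \<theta>[of a] g M by (simp add: invariant_formula_def)
    have ag: "agree ?N (map g x) a = agree M x a" for a x
    proof -
      have "(S ?N (map g x) = S M a) = (S M x = S M a)" if "index_formula L S" for S
        using index_formula_invariant[OF that] g M unfolding invariant_formula_def by simp
      then show ?thesis unfolding agree_def by (intro ball_cong refl) blast
    qed
    have "(\<forall>y. \<exists>c. \<theta> (c # a) ?N (y # x)) \<and> (\<forall>c. \<exists>y. \<theta> (c # a) ?N (y # x)) \<and> agree ?N x a"
      if "\<theta> a ?N x" for a x
    proof -
      obtain z where z: "x = map g z" using map_map_inv[OF g] by metis
      have tc: "\<theta> b ?N (g y # x) = \<theta> b M (y # z)" for b y using t[of b "y # z"] z by simp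
      have M: "\<forall>y. \<exists>c. \<theta> (c # a) M (y # z)" "\<forall>c. \<exists>y. \<theta> (c # a) M (y # z)" "agree M z a"
        using sentM that unfolding sent_def z t by blast+
      have "\<exists>c. \<theta> (c # a) ?N (y # x)" for y
        using M(1) tc[of _ "inv g y"] g by (auto simp: bij_is_surj surj_f_inv_f)
      moreover have "\<exists>y. \<theta> (c # a) ?N (y # x)" for c using M(2) tc by blast
      ultimately show ?thesis using M(3) ag z by blast
    qed
    moreover have "\<theta> [] ?N []" using t[of "[]" "[]"] sentM by (simp add: sent_def)
    ultimately show ?thesis unfolding sent_def by blast
  qed
  have iso: "isomorphic L N M" if N: "N \<in> nat_structures L" and s: "sent N" for N
  proof -
    define T where "T zs \<longleftrightarrow> \<theta> (map snd zs) N (map fst zs)" for zs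
    have T: "agree N (map fst zs) (map snd zs)" if "T zs" for zs
      using s that unfolding sent_def T_def by blast
    obtain h where h: "bij h" "\<And>F. finite F \<Longrightarrow> \<exists>zs. T zs \<and> (\<forall>a\<in>F. (a, h a) \<in> set zs)"
    proof (rule back_and_forth[of T])
      show "T []" using s by (simp add: T_def sent_def)
      show "\<exists>b. T ((a, b) # zs)" if "T zs" for zs a
        using s that unfolding sent_def T_def by simp
      show "\<exists>a. T ((a, b) # zs)" if "T zs" for zs b
        using s that unfolding sent_def T_def by simp
      show "a = a' \<longleftrightarrow> b = b'" if z: "T zs" "(a, b) \<in> set zs" "(a', b') \<in> set zs" for zs a b a' b'
      proof -
        obtain i j where ij: "i < length zs" "zs ! i = (a, b)" "j < length zs" "zs ! j = (a', b')"
          using z(2,3) by (auto simp: in_set_conv_nth)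
        \<comment> \<open>Equality of two entries is one of the atomic formulas, so agreement
          already makes the matching well defined and injective.\<close>
        have "index_formula L (\<lambda>N xs. i < length xs \<and> j < length xs \<and> xs ! i = xs ! j)"
          by (rule index_formula.eq)
        from T[OF z(1), unfolded agree_def, rule_format, unfolded mem_Collect_eq, OF this] show ?thesis using ij by simp
      qed
    qed blast
    have "isomorphism L N M h"
    proof (rule isomorphismI_index_formula[OF N M h(1)])
      fix F :: "nat set" assume "finite F"
      then obtain zs where zs: "T zs" "\<forall>a\<in>F. (a, h a) \<in> set zs" using h(2) by blast
      show "\<exists>zs. (\<forall>S. index_formula L S \<longrightarrow> S N (map fst zs) = S M (map snd zs)) \<and>
          (\<forall>a\<in>F. (a, h a) \<in> set zs)"
        by (rule exI[of _ zs]) (use T[OF zs(1)] zs(2) in \<open>simp add: agree_def\<close>)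
    qed
    then show ?thesis by (auto simp: isomorphic_def)
  qed
  have "isomorphic L N M \<longleftrightarrow> sent N" if N: "N \<in> nat_structures L" for N
  proof
    assume "isomorphic L N M"
    then obtain h where h: "isomorphism L N M h" by (auto simp: isomorphic_def)
    then have "M = logic_action L h N" "bij h"
      using N M isomorphism_eq_logic_action isomorphism_bij by blast+
    then have "N = logic_action L (inv h) M" using logic_action_inv(1) N by metis
    then show "sent N" using sentN bij_imp_bij_inv[OF \<open>bij h\<close>] by simp
  qed (rule iso[OF N])
  then have "{N \<in> nat_structures L. isomorphic L N M} = {N \<in> space (structure_space L). sent N}"
    by auto
  moreover have "Measurable.pred (structure_space L) sent"
  proof -
    have [measurable]: "Measurable.pred (structure_space L) (\<lambda>N. \<theta> a N x)" for a x
      using \<theta> by (simp add: invariant_formula_def)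
    have [measurable]: "Measurable.pred (structure_space L) (\<lambda>N. agree N x a)" for x a
      unfolding agree_def pred_def
    proof (rule sets.sets_Collect_countable_All'[OF _ countable_index_formula[OF L]])
      fix S assume "S \<in> {S. index_formula L S}"
      then have [measurable]: "Measurable.pred (structure_space L) (\<lambda>N. S N x)"
        using index_formula_invariant by (auto simp: invariant_formula_def)
      show "{N \<in> space (structure_space L). S N x = S M a} \<in> sets (structure_space L)" by measurable
    qed
    show ?thesis unfolding sent_def by measurable
  qed
  ultimately show ?thesis by (simp add: pred_def)
qed

section \<open>Permutation groups with trivial definable closure\<close>

locale trivial_dcl_group =
  fixes G :: "(nat \<Rightarrow> nat) set"
  assumes G_bij: "u \<in> G \<Longrightarrow> bij u"
    and G_id: "id \<in> G"
    and G_comp: "u \<in> G \<Longrightarrow> v \<in> G \<Longrightarrow> u \<circ> v \<in> G"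
    and G_inv: "u \<in> G \<Longrightarrow> inv u \<in> G"
    and G_move: "finite F \<Longrightarrow> d \<notin> F \<Longrightarrow> \<exists>u\<in>G. (\<forall>a\<in>F. u a = a) \<and> u d \<noteq> d"
begin

lemma G_eq_iff: "u \<in> G \<Longrightarrow> u x = u y \<longleftrightarrow> x = y"
  using G_bij by (meson bij_is_inj injD)

text \<open>Trivial definable closure implies trivial algebraic closure: a permutation fixing the rest of
  \<open>B\<close> and moving \<open>d\<close> cannot map \<open>d\<close> into \<open>B\<close>.\<close>

lemma G_move_away:
  assumes "finite A" "finite B" "d \<notin> A"
  shows "\<exists>u\<in>G. (\<forall>a\<in>A. u a = a) \<and> u d \<notin> B"
proof -
  obtain u where u: "u \<in> G" "\<forall>a\<in>A \<union> (B - {d}). u a = a" "u d \<noteq> d"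
    using G_move[of "A \<union> (B - {d})" d] assms by auto
  have "u d \<notin> B"
  proof
    assume "u d \<in> B"
    then have "u (u d) = u d" using u by blast
    then show False using u G_eq_iff by blast
  qed
  then show ?thesis using u by (intro bexI[of _ u]) simp_all
qed

text \<open>In a sequence \<open>e 1, e 2, \<dots>\<close> the element \<open>e (Suc k)\<close> is either free (\<open>p k = 0\<close>) or a duplicate
  of its parent \<open>e (p k)\<close> over all other earlier elements.\<close>

definition valid :: "nat \<Rightarrow> (nat \<Rightarrow> nat) \<Rightarrow> (nat \<Rightarrow> nat) \<Rightarrow> bool" where
  "valid n e p \<longleftrightarrow> inj_on e {1..n} \<and> (\<forall>k<n. p k \<le> k \<and>
     (p k \<noteq> 0 \<longrightarrow> (\<exists>u\<in>G. u (e (p k)) = e (Suc k) \<and> (\<forall>m\<in>{1..k} - {p k}. u (e m) = e m))))"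

lemma validD:
  assumes "valid n e p"
  shows "inj_on e {1..n}" and "k < n \<Longrightarrow> p k \<le> k"
    and "k < n \<Longrightarrow> p k \<noteq> 0 \<Longrightarrow>
      \<exists>u\<in>G. u (e (p k)) = e (Suc k) \<and> (\<forall>m\<in>{1..k} - {p k}. u (e m) = e m)"
  using assms unfolding valid_def by blast+

section \<open>Finite approximations of a generic sequence\<close>

definition agree :: "nat \<Rightarrow> (nat \<Rightarrow> nat) \<Rightarrow> (nat \<Rightarrow> nat) \<Rightarrow> (nat \<Rightarrow> nat) \<Rightarrow> (nat \<Rightarrow> nat) \<Rightarrow> bool" where
  "agree n e p e' p' \<longleftrightarrow> (\<forall>m\<in>{1..n}. e' m = e m) \<and> (\<forall>k<n. p' k = p k)"

definition has_child :: "nat \<Rightarrow> nat \<Rightarrow> nat \<Rightarrow> (nat \<Rightarrow> nat) \<Rightarrow> bool" where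
  "has_child N q n p \<longleftrightarrow> (\<exists>k\<in>{N..<n}. p k = q)"

text \<open>\<open>map u (map e ms) = b\<close> with \<open>u\<close> in \<open>G\<close> says that
  the tuple at the indices \<open>ms\<close> lies in the orbit of \<open>b\<close>. Every such tuple
  below the common bound \<open>t\<close> gets its witness within one run of free steps starting at
  \<open>t\<close>; walks that already have a position stand still during such a run. The bound
  \<open>n\<close> makes this a requirement on a finite approximation, so extending it does no
  harm.\<close>

definition has_witnesses ::
  "nat \<Rightarrow> nat list \<Rightarrow> nat \<Rightarrow> nat \<Rightarrow> (nat \<Rightarrow> nat) \<Rightarrow> (nat \<Rightarrow> nat) \<Rightarrow> bool" where
  "has_witnesses N b d n e p \<longleftrightarrow> (\<exists>t\<ge>N. t \<le> n \<and>
     (\<forall>ms. set ms \<subseteq> {1..t} \<longrightarrow> (\<exists>u\<in>G. map u (map e ms) = b) \<longrightarrow>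
       (\<exists>k\<in>{t..<n}. (\<forall>j\<in>{t..k}. p j = 0) \<and> (\<exists>u\<in>G. map u (map e (Suc k # ms)) = d # b))))"

lemma agree_refl [simp]: "agree n e p e p"
  by (simp add: agree_def)

lemma agree_trans:
  "agree n e p e' p' \<Longrightarrow> agree n' e' p' e'' p'' \<Longrightarrow> n \<le> n' \<Longrightarrow> agree n e p e'' p''"
  by (simp add: agree_def)

lemma agree_map: "agree n e p e' p' \<Longrightarrow> set ms \<subseteq> {1..n} \<Longrightarrow> map e' ms = map e ms"
  unfolding agree_def by (intro map_cong refl) blast

lemma valid_agree:
  assumes "agree n e p e' p'" "valid n e p"
  shows "valid n e' p'"
proof -
  have e: "e' m = e m" if "1 \<le> m" "m \<le> n" for m using assms(1) that by (simp add: agree_def)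
  have p: "p' k = p k" if "k < n" for k using assms(1) that by (simp add: agree_def)
  show ?thesis unfolding valid_def
  proof (intro conjI allI impI)
    show "inj_on e' {1..n}"
      using validD(1)[OF assms(2)] inj_on_cong[of "{1..n}" e' e] e by simp
    fix k assume k: "k < n"
    then show "p' k \<le> k" using validD(2)[OF assms(2)] p by simp
    assume "p' k \<noteq> 0"
    then have "p k \<noteq> 0" using p k by simp
    then obtain u where u: "u \<in> G" "u (e (p k)) = e (Suc k)" "\<forall>m\<in>{1..k} - {p k}. u (e m) = e m"
      using validD(3)[OF assms(2) k] by blast
    moreover have "1 \<le> p k" "p k \<le> n" using k p \<open>p' k \<noteq> 0\<close> \<open>p' k \<le> k\<close> by auto
    ultimately show "\<exists>u\<in>G. u (e' (p' k)) = e' (Suc k) \<and> (\<forall>m\<in>{1..k} - {p' k}. u (e' m) = e' m)"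
      using k e p by (intro bexI[of _ u]) auto
  qed
qed

lemma valid_le:
  assumes v: "valid n e p" and t: "t \<le> n"
  shows "valid t e p"
  unfolding valid_def
proof (intro conjI allI impI)
  show "inj_on e {1..t}" by (rule inj_on_subset[OF validD(1)[OF v]]) (use t in auto)
  fix k assume "k < t"
  then have k: "k < n" using t by simp
  then show "p k \<le> k" by (rule validD(2)[OF v])
  assume "p k \<noteq> 0"
  then show "\<exists>u\<in>G. u (e (p k)) = e (Suc k) \<and> (\<forall>m\<in>{1..k} - {p k}. u (e m) = e m)"
    by (rule validD(3)[OF v k])
qed

lemma has_child_agree:
  "agree n e p e' p' \<Longrightarrow> has_child N q n p \<Longrightarrow> has_child N q n p'"
  unfolding agree_def has_child_def by (metis atLeastLessThan_iff)

lemma has_witnesses_agree: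
  assumes a: "agree n e p e' p'" and w: "has_witnesses N b d n e p"
  shows "has_witnesses N b d n e' p'"
proof -
  obtain t where t: "t \<ge> N" "t \<le> n" and w: "\<And>ms. set ms \<subseteq> {1..t} \<Longrightarrow>
    (\<exists>u\<in>G. map u (map e ms) = b) \<Longrightarrow>
    \<exists>k\<in>{t..<n}. (\<forall>j\<in>{t..k}. p j = 0) \<and> (\<exists>u\<in>G. map u (map e (Suc k # ms)) = d # b)"
    using w unfolding has_witnesses_def by blast
  have "\<exists>k\<in>{t..<n}. (\<forall>j\<in>{t..k}. p' j = 0) \<and> (\<exists>u\<in>G. map u (map e' (Suc k # ms)) = d # b)"
    if ms: "set ms \<subseteq> {1..t}" and u: "\<exists>u\<in>G. map u (map e' ms) = b" for ms
  proof -
    have eq: "map e' ms = map e ms" using ms t by (intro agree_map[OF a]) auto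
    from w[OF ms u[unfolded eq]] obtain k where k: "k \<in> {t..<n}"
      "(\<forall>j\<in>{t..k}. p j = 0) \<and> (\<exists>u\<in>G. map u (map e (Suc k # ms)) = d # b)"
      by (rule bexE)
    moreover have "map e' (Suc k # ms) = map e (Suc k # ms)"
      using ms t k(1) by (intro agree_map[OF a]) auto
    moreover have "\<forall>j\<in>{t..k}. p' j = 0" using a k by (auto simp: agree_def)
    ultimately show ?thesis by metis
  qed
  then show ?thesis unfolding has_witnesses_def using t by blast
qed

lemma valid_Suc:
  assumes v: "valid n e p" and c: "c \<notin> e ` {1..n}" and q: "q \<le> n"
    and dup: "q \<noteq> 0 \<Longrightarrow> \<exists>u\<in>G. u (e q) = c \<and> (\<forall>m\<in>{1..n} - {q}. u (e m) = e m)"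
  shows "valid (Suc n) (e(Suc n := c)) (p(n := q))" "agree n e p (e(Suc n := c)) (p(n := q))"
proof -
  show a: "agree n e p (e(Suc n := c)) (p(n := q))" by (auto simp: agree_def)
  then have v': "valid n (e(Suc n := c)) (p(n := q))" using v by (rule valid_agree)
  have "(e(Suc n := c)) ` {1..n} = e ` {1..n}" by (intro image_cong) auto
  moreover have "{1..Suc n} = insert (Suc n) {1..n}" "{1..n} - {Suc n} = {1..n}" by auto
  ultimately have inj: "inj_on (e(Suc n := c)) {1..Suc n}"
    using validD(1)[OF v'] c by (simp only: inj_on_insert) simp
  have dup': "\<exists>u\<in>G. u ((e(Suc n := c)) q) = c \<and>
      (\<forall>m\<in>{1..n} - {q}. u ((e(Suc n := c)) m) = (e(Suc n := c)) m)" if "q \<noteq> 0"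
  proof -
    obtain u where "u \<in> G" "u (e q) = c" "\<forall>m\<in>{1..n} - {q}. u (e m) = e m"
      using dup[OF \<open>q \<noteq> 0\<close>] by blast
    then show ?thesis using q by (intro bexI[of _ u]) simp_all
  qed
  show "valid (Suc n) (e(Suc n := c)) (p(n := q))"
    unfolding valid_def
  proof (intro conjI allI impI)
    fix k assume k: "k < Suc n"
    show "(p(n := q)) k \<le> k"
      using validD(2)[OF v', of k] q k by (cases "k = n") auto
    assume "(p(n := q)) k \<noteq> 0"
    then show "\<exists>u\<in>G. u ((e(Suc n := c)) ((p(n := q)) k)) = (e(Suc n := c)) (Suc k) \<and>
        (\<forall>m\<in>{1..k} - {(p(n := q)) k}. u ((e(Suc n := c)) m) = (e(Suc n := c)) m)"
      using validD(3)[OF v', of k] dup' k by (cases "k = n") auto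
  qed (rule inj)
qed

text \<open>A free element only has to be new, so padding with free elements is always
  possible.\<close>

lemma valid_reach:
  assumes "n \<le> N" "valid n e p"
  obtains e' p' where "valid N e' p'" "agree n e p e' p'"
proof -
  have "\<exists>e' p'. valid N e' p' \<and> agree n e p e' p'"
    using assms(1)
  proof (induction N rule: dec_induct)
    case base
    show ?case using assms(2) agree_refl by blast
  next
    case (step m)
    then obtain e' p' where *: "valid m e' p'" "agree n e p e' p'" by blast
    obtain c where "c \<notin> e' ` {1..m}" using ex_new_if_finite[of "e' ` {1..m}"] by auto
    from valid_Suc[OF *(1) this, of 0] *(2) step.hyps show ?case
      by (metis agree_trans le0)
  qed
  then show thesis using that by blast
qed

lemma valid_child:
  assumes "valid n e p"
  obtains n' e' p' where "n \<le> n'" "valid n' e' p'" "agree n e p e' p'" "has_child N q n' p'"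
proof -
  \<comment> \<open>At length \<open>M\<close> the index \<open>q\<close> already exists, and the
    step about to be added has index \<open>M\<close>, which is at least \<open>N\<close>.\<close>
  define M where "M = max n (max N q)"
  obtain e' p' where v: "valid M e' p'" and a: "agree n e p e' p'"
    using valid_reach[OF _ assms, of M] by (auto simp: M_def)
  have "\<exists>c. c \<notin> e' ` {1..M} \<and>
    (q \<noteq> 0 \<longrightarrow> (\<exists>u\<in>G. u (e' q) = c \<and> (\<forall>m\<in>{1..M} - {q}. u (e' m) = e' m)))"
  proof (cases "q = 0")
    case True
    then show ?thesis using ex_new_if_finite[of "e' ` {1..M}"] by auto
  next
    case False
    then have "q \<in> {1..M}" by (auto simp: M_def)
    then have "e' q \<notin> e' ` ({1..M} - {q})" by (simp add: inj_on_image_mem_iff[OF validD(1)[OF v]])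
    then have "\<exists>u\<in>G. (\<forall>a\<in>e' ` ({1..M} - {q}). u a = a) \<and> u (e' q) \<notin> e' ` {1..M}"
      by (intro G_move_away) simp_all
    then obtain u where "u \<in> G" "\<forall>a\<in>e' ` ({1..M} - {q}). u a = a" "u (e' q) \<notin> e' ` {1..M}"
      by blast
    then show ?thesis by (intro exI[of _ "u (e' q)"] conjI impI bexI[of _ u]) simp_all
  qed
  then obtain c where c: "c \<notin> e' ` {1..M}"
    "q \<noteq> 0 \<Longrightarrow> \<exists>u\<in>G. u (e' q) = c \<and> (\<forall>m\<in>{1..M} - {q}. u (e' m) = e' m)" by blast
  have "q \<le> M" by (simp add: M_def)
  note * = valid_Suc[OF v c(1) this c(2)]
  show thesis
  proof (rule that[OF _ *(1)])
    show "agree n e p (e'(Suc M := c)) (p'(M := q))"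
      by (rule agree_trans[OF a *(2)]) (auto simp: M_def)
  qed (auto simp: M_def has_child_def)
qed

text \<open>\<open>inv u d\<close> extends \<open>map e ms\<close> in the required way but may
  already occur in the sequence. An element \<open>w\<close> of \<open>G\<close> fixing the tuple
  moves it to a fresh place without changing its type over the tuple, and
  \<open>u \<circ> inv w\<close> undoes the move.\<close>

lemma valid_witness:
  assumes v: "valid n e p" and ms: "set ms \<subseteq> {1..n}" and u: "u \<in> G" "map u (map e ms) = b"
    and d: "d \<notin> set b"
  obtains c w where "c \<notin> e ` {1..n}" "w \<in> G" "map w (c # map e ms) = d # b"
proof -
  have "inv u d \<notin> e ` set ms"
  proof
    assume "inv u d \<in> e ` set ms"
    then have "u (inv u d) \<in> set b" using u by auto
    then show False using d u G_bij by (simp add: bij_is_surj surj_f_inv_f)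
  qed
  then have "\<exists>w\<in>G. (\<forall>a\<in>e ` set ms. w a = a) \<and> w (inv u d) \<notin> e ` {1..n}"
    by (intro G_move_away) simp_all
  then obtain w where w: "w \<in> G" "\<forall>a\<in>e ` set ms. w a = a" "w (inv u d) \<notin> e ` {1..n}"
    by blast
  have "inv w a = a" if "a \<in> e ` set ms" for a
    using bspec[OF w(2) that] inv_f_f[OF bij_is_inj[OF G_bij[OF w(1)]], of a] by simp
  then have "map (u \<circ> inv w) (map e ms) = b" using u(2) by auto
  moreover have "(u \<circ> inv w) (w (inv u d)) = d"
    using u w G_bij by (simp add: bij_is_inj bij_is_surj surj_f_inv_f)
  ultimately show thesis
    using that[OF w(3), of "u \<circ> inv w"] u(1) w(1) G_inv G_comp by simp
qed

lemma valid_witnesses: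
  assumes v: "valid n e p" and d: "d \<notin> set b"
  obtains n' e' p' where "n \<le> n'" "valid n' e' p'" "agree n e p e' p'" "has_witnesses N b d n' e' p'"
proof -
  \<comment> \<open>The bound is frozen before any witness is added: tuples using the new elements
    need no witness in this run, so the family of tuples to serve stays finite.\<close>
  define t where "t = max n N"
  obtain e1 p1 where v1: "valid t e1 p1" and a1: "agree n e p e1 p1"
    using valid_reach[OF _ v, of t] by (auto simp: t_def)
  \<comment> \<open>The requirement for a single tuple, without the freeness clause. Freeness is
    carried through the induction once, for the whole run from \<open>t\<close> on.\<close>
  define W where "W n e ms \<longleftrightarrow> ((\<exists>u\<in>G. map u (map e ms) = b) \<longrightarrow>
      (\<exists>k\<in>{t..<n}. \<exists>u\<in>G. map u (map e (Suc k # ms)) = d # b))" for n e ms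
  have *: "\<exists>n' e' p'. t \<le> n' \<and> valid n' e' p' \<and> agree t e1 p1 e' p' \<and> (\<forall>j\<in>{t..<n'}. p' j = 0) \<and>
      (\<forall>ms\<in>A. W n' e' ms)"
    if "finite A" "\<forall>ms\<in>A. set ms \<subseteq> {1..t}" for A
    using that
  proof (induction A)
    case empty
    show ?case using v1 by (intro exI[of _ t] exI[of _ e1] exI[of _ p1]) auto
  next
    case (insert ms A)
    then obtain n' e' p' where n': "t \<le> n'" "valid n' e' p'" and a': "agree t e1 p1 e' p'"
      and z: "\<forall>j\<in>{t..<n'}. p' j = 0" and w: "\<forall>ms\<in>A. W n' e' ms" by auto
    show ?case
    proof (cases "\<exists>u\<in>G. map u (map e' ms) = b")
      case False
      then have "W n' e' ms" by (simp only: W_def simp_thms)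
      then show ?thesis using n' a' z w by (intro exI[of _ n'] exI[of _ e'] exI[of _ p']) simp
    next
      case True
      have ms: "set ms \<subseteq> {1..n'}" using insert.prems n'(1) by force
      obtain c f where c: "c \<notin> e' ` {1..n'}" and f: "f \<in> G" "map f (c # map e' ms) = d # b"
        using True valid_witness[OF n'(2) ms _ _ d] by blast
      let ?e = "e'(Suc n' := c)" and ?p = "p'(n' := 0)"
      have v2: "valid (Suc n') ?e ?p" and a2: "agree n' e' p' ?e ?p"
        using valid_Suc[OF n'(2) c, of 0] by auto
      have e2: "map ?e xs = map e' xs" if "set xs \<subseteq> {1..n'}" for xs
        using agree_map[OF a2 that] .
      have "W (Suc n') ?e xs" if xs: "xs \<in> insert ms A" for xs
        unfolding W_def
      proof
        assume u: "\<exists>u\<in>G. map u (map ?e xs) = b"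
        have sub: "set xs \<subseteq> {1..n'}" using insert.prems xs n'(1) by force
        show "\<exists>k\<in>{t..<Suc n'}. \<exists>u\<in>G. map u (map ?e (Suc k # xs)) = d # b"
        proof (cases "xs = ms")
          case True
          then have "map ?e (Suc n' # xs) = c # map e' ms" using e2[OF sub] by (simp del: map_eq_conv)
          then have "map f (map ?e (Suc n' # xs)) = d # b" using f(2) by (simp only:)
          then have "\<exists>u\<in>G. map u (map ?e (Suc n' # xs)) = d # b" using f(1) by (rule bexI)
          then show ?thesis by (rule bexI) (use n'(1) in simp)
        next
          case False
          then have "xs \<in> A" using xs by simp
          with w have "W n' e' xs" by blast
          from this[unfolded W_def, rule_format, OF u[unfolded e2[OF sub]]] obtain k
            where k: "k \<in> {t..<n'}" "\<exists>u\<in>G. map u (map e' (Suc k # xs)) = d # b" by (rule bexE)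
          have eq: "map ?e (Suc k # xs) = map e' (Suc k # xs)"
            using k(1) sub by (intro e2) auto
          show ?thesis
          proof (rule bexI[of _ k])
            show "\<exists>u\<in>G. map u (map ?e (Suc k # xs)) = d # b" unfolding eq by (rule k(2))
          qed (use k(1) in simp)
        qed
      qed
      moreover have "agree t e1 p1 ?e ?p" using a' a2 n'(1) by (rule agree_trans)
      moreover have "\<forall>j\<in>{t..<Suc n'}. ?p j = 0" using z by auto
      moreover have "t \<le> Suc n'" using n'(1) by simp
      ultimately show ?thesis
        using v2 by - (rule exI[of _ "Suc n'"], rule exI[of _ ?e], rule exI[of _ ?p],
            simp del: fun_upd_apply)
    qed
  qed
  let ?A = "{ms. set ms \<subseteq> {1..t} \<and> length ms = length b}"
  obtain n' e' p' where n': "t \<le> n'" "valid n' e' p'" "agree t e1 p1 e' p'"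
    and z: "\<forall>j\<in>{t..<n'}. p' j = 0" and w: "\<forall>ms\<in>?A. W n' e' ms"
    using *[of ?A] finite_lists_length_eq[of "{1..t}" "length b"] by auto
  have "has_witnesses N b d n' e' p'"
    unfolding has_witnesses_def
  proof (intro exI[of _ t] conjI allI impI)
    fix ms assume ms: "set ms \<subseteq> {1..t}" and u: "\<exists>u\<in>G. map u (map e' ms) = b"
    then have "length ms = length b" by auto
    then have "ms \<in> ?A" using ms by simp
    with w have "W n' e' ms" by blast
    from this[unfolded W_def, rule_format, OF u] obtain k
      where k: "k \<in> {t..<n'}" "\<exists>u\<in>G. map u (map e' (Suc k # ms)) = d # b" by (rule bexE)
    have "\<forall>j\<in>{t..k}. p' j = 0" using z k(1) by auto
    then show "\<exists>k\<in>{t..<n'}. (\<forall>j\<in>{t..k}. p' j = 0) \<and>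
        (\<exists>u\<in>G. map u (map e' (Suc k # ms)) = d # b)"
      using k by (intro bexI[of _ k] conjI)
  qed (use n' in \<open>auto simp: t_def\<close>)
  moreover have "agree n e p e' p'" using a1 n'(3) by (rule agree_trans) (auto simp: t_def)
  ultimately show thesis using that n' by (auto simp: t_def)
qed

text \<open>Each request \<open>(N, q, b, d)\<close> is handled at the single stage that encodes it.
  Since \<open>N\<close> is part of the request, serving all of them yields children and witnesses
  arbitrarily late.\<close>

lemma exists_generic_sequence:
  obtains e p where "\<And>n. valid n e p"
    and "\<And>q N. \<exists>k\<ge>N. p k = q"
    and "\<And>N b d. d \<notin> set b \<Longrightarrow> \<exists>n. has_witnesses N b d n e p"
proof -
  define step where "step k s s' \<longleftrightarrow> (case (s, s') of ((n, e, p), (n', e', p')) \<Rightarrow>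
    n \<le> n' \<and> agree n e p e' p' \<and> (case from_nat k of (N, q, b, d) \<Rightarrow>
      has_child N q n' p' \<and> (d \<notin> set b \<longrightarrow> has_witnesses N b d n' e' p')))" for k s s'
  define ok where "ok s \<longleftrightarrow> (case s of (n, e, p) \<Rightarrow> valid n e p)" for s
  have "\<exists>s'. ok s' \<and> step k s s'" if "ok s" for k s
  proof -
    obtain n e p where s: "s = (n, e, p)" by (cases s)
    obtain N q b d where k: "(from_nat k :: nat \<times> nat \<times> nat list \<times> nat) = (N, q, b, d)"
      by (metis prod_cases4)
    have v: "valid n e p" using that by (simp add: ok_def s)
    obtain n1 e1 p1 where 1: "n \<le> n1" "valid n1 e1 p1" "agree n e p e1 p1" "has_child N q n1 p1"
      using valid_child[OF v] .
    obtain n2 e2 p2 where 2: "n1 \<le> n2" "valid n2 e2 p2" "agree n1 e1 p1 e2 p2"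
      "d \<notin> set b \<longrightarrow> has_witnesses N b d n2 e2 p2"
    proof (cases "d \<in> set b")
      case True
      then show ?thesis using that[of n1 e1 p1] 1(2) by simp
    next
      case False
      obtain n2 e2 p2 where "n1 \<le> n2" "valid n2 e2 p2" "agree n1 e1 p1 e2 p2"
        "has_witnesses N b d n2 e2 p2" using valid_witnesses[OF 1(2) False] .
      then show ?thesis using that by blast
    qed
    have "has_child N q n2 p2"
      using has_child_agree[OF 2(3) 1(4)] 2(1) by (auto simp: has_child_def)
    moreover have "agree n e p e2 p2" using agree_trans[OF 1(3) 2(3) 1(1)] .
    moreover have "n \<le> n2" using 1(1) 2(1) by simp
    ultimately show ?thesis using 2
      by (intro exI[of _ "(n2, e2, p2)"]) (simp add: ok_def step_def s k)
  qed
  moreover have "ok (0, id, id)" by (simp add: ok_def valid_def)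
  ultimately obtain s where s: "\<And>k. ok (s k)" "\<And>k. step k (s k) (s (Suc k))"
    using dependent_nat_choice[of "\<lambda>_. ok" step] by blast
  define l where "l k = fst (s k)" for k
  define E where "E k = fst (snd (s k))" for k
  define P where "P k = snd (snd (s k))" for k
  have s_eq: "s k = (l k, E k, P k)" for k by (simp add: l_def E_def P_def)
  have v: "valid (l k) (E k) (P k)" for k using s(1)[of k] by (simp add: ok_def s_eq)
  have st: "l k \<le> l (Suc k)" "agree (l k) (E k) (P k) (E (Suc k)) (P (Suc k))" for k
    using s(2)[of k] by (auto simp: step_def s_eq)
  have req: "has_child N q (l (Suc k)) (P (Suc k))"
      "d \<notin> set b \<Longrightarrow> has_witnesses N b d (l (Suc k)) (E (Suc k)) (P (Suc k))"
    if "k = to_nat (N, q, b, d)" for k N q b d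
    using s(2)[of k] by (auto simp: step_def s_eq that)
  have mono: "l i \<le> l j" if "i \<le> j" for i j using lift_Suc_mono_le[of l] st(1) that by blast
  have ag: "agree (l i) (E i) (P i) (E j) (P j)" if "i \<le> j" for i j
    using that
  proof (induction j rule: dec_induct)
    case (step m)
    show ?case using agree_trans[OF step.IH st(2) mono[OF step.hyps(1)]] .
  qed simp
  \<comment> \<open>A child at a step not below \<open>n\<close> can only exist in an approximation
    longer than \<open>n\<close>.\<close>
  have unb: "\<exists>k. n < l k" for n
    using req(1)[OF refl, of n 0 "[]" 0] unfolding has_child_def
    by (meson atLeastLessThan_iff le_less_trans)
  \<comment> \<open>The inequality is strict because an approximation of length \<open>l\<close>
    fixes \<open>e\<close> on \<open>{1..l}\<close> but \<open>p\<close> only below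
    \<open>l\<close>; stage \<open>K n\<close> thus decides both \<open>e n\<close> and
    \<open>p n\<close>.\<close>
  define K where "K n = (LEAST k. n < l k)" for n
  have K: "n < l (K n)" for n unfolding K_def using unb by (rule LeastI_ex)
  have K_le: "K n \<le> k" if "n < l k" for n k unfolding K_def using that by (rule Least_le)
  define e where "e m = E (K m) m" for m
  define p where "p m = P (K m) m" for m
  have lim: "agree (l k) (E k) (P k) e p" for k
    unfolding agree_def
  proof (intro conjI ballI allI impI)
    show "e m = E k m" if "m \<in> {1..l k}" for m
    proof (cases "K m \<le> k")
      case True
      then show ?thesis using ag[OF True] K[of m] that by (simp add: e_def agree_def)
    next
      case False
      then show ?thesis using ag[of k "K m"] that by (simp add: e_def agree_def)
    qed
    show "p m = P k m" if "m < l k" for m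
      using ag[OF K_le[OF that]] K[of m] by (simp add: p_def agree_def)
  qed
  show thesis
  proof (rule that)
    show "valid n e p" for n
    proof -
      obtain k where "n < l k" using unb by blast
      then show ?thesis using valid_le[OF valid_agree[OF lim v], of n k] by simp
    qed
    show "\<exists>k\<ge>N. p k = q" for q N
      using has_child_agree[OF lim req(1)[OF refl, of N q "[]" 0]]
      unfolding has_child_def by (meson atLeastLessThan_iff)
    show "\<exists>n. has_witnesses N b d n e p" if "d \<notin> set b" for N b d
      using has_witnesses_agree[OF lim req(2)[OF refl that]] by blast
  qed
qed

end

section \<open>Random walks along a generic sequence\<close>

locale generic_sequence = trivial_dcl_group +
  fixes e p :: "nat \<Rightarrow> nat"
  assumes generic_valid: "valid n e p"
    and generic_child: "\<exists>k\<ge>N. p k = q"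
    and generic_witness: "d \<notin> set b \<Longrightarrow> \<exists>n. has_witnesses N b d n e p"
begin

lemma e_eq_iff: "i \<noteq> 0 \<Longrightarrow> j \<noteq> 0 \<Longrightarrow> e i = e j \<longleftrightarrow> i = j"
  using inj_on_eq_iff[OF validD(1)[OF generic_valid[of "max i j"]], of i j] by auto

lemma duplicate:
  assumes "p n \<noteq> 0"
  shows "\<exists>u\<in>G. u (e (p n)) = e (Suc n) \<and> (\<forall>m\<in>{1..n} - {p n}. u (e m) = e m)"
  by (rule validD(3)[OF generic_valid[of "Suc n"]]) (use assms in auto)

text \<open>A sample is driven by a sequence of coin flips. Its state at time \<open>n\<close> is an index into \<open>e\<close>,
  or \<open>0\<close> as long as no element has been chosen.\<close>

primrec state :: "(nat \<Rightarrow> bool) \<Rightarrow> nat \<Rightarrow> nat" where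
  "state y 0 = 0"
| "state y (Suc n) = (if state y n = p n \<and> y n then Suc n else state y n)"

lemma state_le: "state y n \<le> n"
  by (induction n) (auto intro: le_SucI)

lemma state_nonzero_mono:
  assumes "state y n \<noteq> 0" "n \<le> n'"
  shows "state y n' \<noteq> 0"
  using assms(2,1) by (induction n' rule: dec_induct) simp_all

text \<open>Walks at different positions cannot both stand at \<open>p n\<close>, so at most one
  moves, and the target \<open>Suc n\<close> is larger than every position occupied so far.\<close>

lemma state_neq_Suc:
  assumes "state y n \<noteq> state z n"
  shows "state y (Suc n) \<noteq> state z (Suc n)"
proof -
  have "state y n \<noteq> Suc n" "state z n \<noteq> Suc n" using state_le[of y n] state_le[of z n] by simp_all
  then show ?thesis
    using assms by (cases "state y n = p n \<and> y n"; cases "state z n = p n \<and> z n") simp_all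
qed

lemma state_neq_mono:
  assumes "state y n \<noteq> state z n" "n \<le> n'"
  shows "state y n' \<noteq> state z n'"
  using assms(2)
proof (induction n' rule: dec_induct)
  case (step m)
  show ?case by (rule state_neq_Suc[OF step.IH])
qed (rule assms(1))

text \<open>A free step can be taken only from state \<open>0\<close>. This is what lets a witness
  meet the tuple at the very positions for which it was made.\<close>

lemma state_stable:
  assumes "state y t \<noteq> 0" "t \<le> k" "\<forall>j\<in>{t..k}. p j = 0"
  shows "state y (Suc k) = state y t"
proof -
  have "state y n = state y t" if "t \<le> n" "n \<le> Suc k" for n
    using that
  proof (induction n rule: dec_induct)
    case (step m)
    then have IH: "state y m = state y t" by simp
    have "p m = 0" using assms(3) step by simp
    then show ?case using assms(1) by (simp add: IH)
  qed simp
  from this[of "Suc k"] show ?thesis using assms(2) by simp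
qed

text \<open>If the current position were never a parent again, the walk would stand still from then
  on, yet its fixed position has children arbitrarily late.\<close>

lemma parent_state_infinite: "infinite {n. p n = state y n}"
proof -
  have "\<exists>n\<ge>N. p n = state y n" for N
  proof (rule ccontr)
    assume "\<not> (\<exists>n\<ge>N. p n = state y n)"
    then have ne: "state y n \<noteq> p n" if "N \<le> n" for n using that by force
    have const: "state y n = state y N" if "N \<le> n" for n
      using that by (induction n rule: dec_induct) (use ne in auto)
    obtain k where "k \<ge> N" "p k = state y N" using generic_child by blast
    then show False using ne[of k] const[of k] by simp
  qed
  then show ?thesis by (auto simp: infinite_nat_iff_unbounded_le)
qed

lemma free_infinite: "infinite {n. p n = 0}"
  using generic_child[of _ 0] by (auto simp: infinite_nat_iff_unbounded_le)

definition separated :: "(nat \<Rightarrow> nat \<Rightarrow> bool) \<Rightarrow> nat set \<Rightarrow> nat \<Rightarrow> bool" where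
  "separated w I n \<longleftrightarrow> inj_on (\<lambda>i. state (w i) n) I \<and> (\<forall>i\<in>I. state (w i) n \<noteq> 0)"

lemma separated_mono: "separated w I n \<Longrightarrow> n \<le> n' \<Longrightarrow> separated w I n'"
  unfolding separated_def inj_on_def using state_neq_mono state_nonzero_mono by meson

text \<open>Separated samples keep their joint type: at most one of them moves, and it moves to a duplicate
  over all the others.\<close>

lemma separated_Suc:
  assumes "separated w I n"
  shows "\<exists>u\<in>G. \<forall>i\<in>I. u (e (state (w i) n)) = e (state (w i) (Suc n))"
proof (cases "\<exists>i0\<in>I. state (w i0) n = p n \<and> w i0 n")
  case True
  then obtain i0 where i0: "i0 \<in> I" "state (w i0) n = p n" "w i0 n" by blast
  have "p n \<noteq> 0" using i0 assms by (auto simp: separated_def)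
  from duplicate[OF this] obtain u where u: "u \<in> G" and
    u2: "u (e (p n)) = e (Suc n) \<and> (\<forall>m\<in>{1..n} - {p n}. u (e m) = e m)" by (rule bexE)
  have "u (e (state (w i) n)) = e (state (w i) (Suc n))" if i: "i \<in> I" for i
  proof (cases "i = i0")
    case True
    then show ?thesis using u2 i0 by simp
  next
    case False
    then have ne: "state (w i) n \<noteq> p n"
      using assms i i0 unfolding separated_def inj_on_def by metis
    have "state (w i) n \<noteq> 0" using assms i by (simp add: separated_def)
    then have "state (w i) n \<in> {1..n} - {p n}" using ne state_le[of "w i" n] by simp
    with u2 show ?thesis using ne by simp
  qed
  then show ?thesis using u by (intro bexI[of _ u] ballI)
next
  case False
  then have "\<forall>i\<in>I. id (e (state (w i) n)) = e (state (w i) (Suc n))" by auto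
  then show ?thesis using G_id by (rule bexI)
qed

text \<open>Each step moves the tuple of positions by some \<open>f\<close> in \<open>G\<close>;
  composing with \<open>inv f\<close> corrects the map and keeps the target \<open>h\<close>
  unchanged.\<close>

lemma separated_type:
  assumes "separated w I n" "n \<le> n'" "u \<in> G" "\<And>i. i \<in> I \<Longrightarrow> u (e (state (w i) n)) = h i"
  shows "\<exists>v\<in>G. \<forall>i\<in>I. v (e (state (w i) n')) = h i"
  using assms(2)
proof (induction n' rule: dec_induct)
  case base
  show ?case using assms(3,4) by (intro bexI[of _ u] ballI)
next
  case (step m)
  obtain v where v: "v \<in> G" and v2: "\<forall>i\<in>I. v (e (state (w i) m)) = h i"
    using step.IH by (rule bexE)
  obtain f where f: "f \<in> G" and f2: "\<forall>i\<in>I. f (e (state (w i) m)) = e (state (w i) (Suc m))"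
    using separated_Suc[OF separated_mono[OF assms(1) step.hyps(1)]] by (rule bexE)
  have "(v \<circ> inv f) (e (state (w i) (Suc m))) = h i" if "i \<in> I" for i
  proof -
    have "inv f (e (state (w i) (Suc m))) = e (state (w i) m)"
      using bspec[OF f2 that] inv_f_f[OF bij_is_inj[OF G_bij[OF f]], of "e (state (w i) m)"] by simp
    then show ?thesis using bspec[OF v2 that] by simp
  qed
  then show ?case using G_comp[OF v G_inv[OF f]] by (intro bexI[of _ "v \<circ> inv f"] ballI)
qed

text \<open>These are the almost sure properties that back-and-forth consumes. The first two make
  any finite set of walks separated eventually; the third provides, for each free element, a walk
  that takes it at the moment it appears.\<close>

definition good :: "(nat \<Rightarrow> nat \<Rightarrow> bool) \<Rightarrow> bool" where
  "good w \<longleftrightarrow> (\<forall>i j. i \<noteq> j \<longrightarrow> (\<exists>n. state (w i) n \<noteq> state (w j) n)) \<and>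
     (\<forall>i. \<exists>n. state (w i) n \<noteq> 0) \<and>
     (\<forall>n. p n = 0 \<longrightarrow> (\<exists>j. state (w j) (Suc n) = Suc n))"

lemma good_separated:
  assumes "good w" "finite I"
  shows "\<exists>n\<ge>N. separated w I n"
proof -
  have "\<forall>\<^sub>F n in sequentially. state (w i) n \<noteq> state (w j) n" if ij: "i \<noteq> j" for i j
  proof -
    obtain n where "state (w i) n \<noteq> state (w j) n" using assms(1) ij unfolding good_def by blast
    then show ?thesis
      using state_neq_mono unfolding eventually_sequentially by blast
  qed
  then have "\<forall>\<^sub>F n in sequentially. i \<noteq> j \<longrightarrow> state (w i) n \<noteq> state (w j) n" for i j
    by (cases "i = j") auto
  then have 1: "\<forall>\<^sub>F n in sequentially. \<forall>i\<in>I. \<forall>j\<in>I. i \<noteq> j \<longrightarrow> state (w i) n \<noteq> state (w j) n"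
    using assms(2) by (intro eventually_ball_finite ballI) auto
  have "\<forall>\<^sub>F n in sequentially. state (w i) n \<noteq> 0" for i
  proof -
    obtain n where "state (w i) n \<noteq> 0" using assms(1) unfolding good_def by blast
    then show ?thesis
      using state_nonzero_mono unfolding eventually_sequentially by blast
  qed
  then have 2: "\<forall>\<^sub>F n in sequentially. \<forall>i\<in>I. state (w i) n \<noteq> 0"
    using assms(2) by (intro eventually_ball_finite ballI)
  have "\<forall>\<^sub>F n in sequentially. n \<ge> N \<and> separated w I n"
    using 1 2 eventually_ge_at_top[of N]
    by eventually_elim (auto simp: separated_def inj_on_def)
  then show ?thesis using eventually_happens'[OF sequentially_bot] by blast
qed

text \<open>The element of \<open>G\<close> may change with \<open>n\<close>, since positions keep
  moving within an orbit. Accordingly \<open>h\<close> is not unique: composing it with a member of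
  \<open>G\<close> gives another limit.\<close>

definition limit_bij :: "(nat \<Rightarrow> nat \<Rightarrow> bool) \<Rightarrow> (nat \<Rightarrow> nat) \<Rightarrow> bool" where
  "limit_bij w h \<longleftrightarrow> bij h \<and> (\<forall>F. finite F \<longrightarrow>
     (\<forall>\<^sub>F n in sequentially. \<exists>u\<in>G. \<forall>i\<in>F. u (e (state (w i) n)) = h i))"

lemma good_limit_bij:
  assumes good: "good w"
  shows "\<exists>h. limit_bij w h"
proof -
  \<comment> \<open>A finite matching counts as correct if the positions of its walks, at some time
    when they are separated, are carried to their partners by one member of \<open>G\<close>. By
    \<open>T_later\<close> the time may then be increased at will.\<close>
  define T where "T zs \<longleftrightarrow> (\<exists>n u. separated w (fst ` set zs) n \<and> u \<in> G \<and>
    (\<forall>z\<in>set zs. u (e (state (w (fst z)) n)) = snd z))" for zs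
  have T_I: "T zs" if "separated w (fst ` set zs) n" "u \<in> G"
    "\<forall>z\<in>set zs. u (e (state (w (fst z)) n)) = snd z" for zs n u
    unfolding T_def using that by - (rule exI[of _ n], rule exI[of _ u], intro conjI)
  have T_later: "\<exists>u\<in>G. \<forall>z\<in>set zs. u (e (state (w (fst z)) n')) = snd z"
    if sep: "separated w (fst ` set zs) n" and n: "n \<le> n'" and u: "u \<in> G"
      and z: "\<forall>z\<in>set zs. u (e (state (w (fst z)) n)) = snd z" for zs n n' u
  proof -
    have u': "u (e (state (w i) n)) = u (e (state (w i) n))" for i ..
    obtain v where v: "v \<in> G"
      and v2: "\<forall>i\<in>fst ` set zs. v (e (state (w i) n')) = u (e (state (w i) n))"
      using separated_type[OF sep n u u'] by (rule bexE)
    have "\<forall>z\<in>set zs. v (e (state (w (fst z)) n')) = snd z" using v2 z by simp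
    then show ?thesis using v by (rule bexI)
  qed
  obtain h where h: "bij h" and hT: "\<And>F. finite F \<Longrightarrow> \<exists>zs. T zs \<and> (\<forall>a\<in>F. (a, h a) \<in> set zs)"
  proof (rule back_and_forth[of T])
    show "T []" by (rule T_I[OF _ G_id, of _ 0]) (simp_all add: separated_def)
  next
    fix zs :: "(nat \<times> nat) list" and a assume "T zs" "a \<notin> fst ` set zs"
    then obtain n u where n: "separated w (fst ` set zs) n" and u: "u \<in> G"
      and z: "\<forall>z\<in>set zs. u (e (state (w (fst z)) n)) = snd z"
      unfolding T_def by (elim exE conjE) (rule that)
    \<comment> \<open>The forth step only waits until the new walk is separated from the others; its
      partner is then read off from its position.\<close>
    obtain n' where n': "n \<le> n'" "separated w (insert a (fst ` set zs)) n'"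
      using good_separated[OF good, of "insert a (fst ` set zs)" n] by auto
    obtain v where v: "v \<in> G" and vz: "\<forall>z\<in>set zs. v (e (state (w (fst z)) n')) = snd z"
      using T_later[OF n n'(1) u z] by (rule bexE)
    let ?zs = "(a, v (e (state (w a) n'))) # zs"
    have "T ?zs"
    proof (rule T_I[OF _ v])
      show "separated w (fst ` set ?zs) n'" using n' by simp
      show "\<forall>z\<in>set ?zs. v (e (state (w (fst z)) n')) = snd z" using vz by simp
    qed
    then show "\<exists>b. T ((a, b) # zs)" by blast
  next
    fix zs :: "(nat \<times> nat) list" and b assume "T zs" "b \<notin> snd ` set zs"
    then obtain n u where n: "separated w (fst ` set zs) n" and u: "u \<in> G"
      and z: "\<forall>z\<in>set zs. u (e (state (w (fst z)) n)) = snd z"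
      unfolding T_def by (elim exE conjE) (rule that)
    have "b \<notin> set (map snd zs)" using \<open>b \<notin> snd ` set zs\<close> by simp
    \<comment> \<open>Taking \<open>n\<close> as lower bound makes the run of witnesses start when
      the walks of \<open>zs\<close> are already separated.\<close>
    then obtain m where "has_witnesses n (map snd zs) b m e p" using generic_witness by blast
    then obtain t where t: "n \<le> t" and wit: "\<forall>ms. set ms \<subseteq> {1..t} \<longrightarrow>
      (\<exists>u\<in>G. map u (map e ms) = map snd zs) \<longrightarrow> (\<exists>k\<in>{t..<m}. (\<forall>j\<in>{t..k}. p j = 0) \<and>
        (\<exists>u\<in>G. map u (map e (Suc k # ms)) = b # map snd zs))"
      unfolding has_witnesses_def by (elim exE conjE) (rule that)
    define ms where "ms = map (\<lambda>z. state (w (fst z)) t) zs"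
    have sep: "separated w (fst ` set zs) t" using separated_mono[OF n t] .
    then have ms1: "set ms \<subseteq> {1..t}"
    proof -
      have "state (w (fst z)) t \<in> {1..t}" if "z \<in> set zs" for z
        using sep that state_le[of "w (fst z)" t] by (auto simp: separated_def Suc_le_eq)
      then show ?thesis by (simp only: ms_def set_map image_subset_iff) blast
    qed
    obtain v where v: "v \<in> G" and vz: "\<forall>z\<in>set zs. v (e (state (w (fst z)) t)) = snd z"
      using T_later[OF n t u z] by (rule bexE)
    have "map v (map e ms) = map snd zs" using vz by (simp add: ms_def)
    then have "\<exists>u\<in>G. map u (map e ms) = map snd zs" using v by (rule bexI)
    from wit[rule_format, OF ms1 this] obtain k where k: "k \<in> {t..<m}" and
      k2: "(\<forall>j\<in>{t..k}. p j = 0) \<and> (\<exists>u\<in>G. map u (map e (Suc k # ms)) = b # map snd zs)"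
      by (rule bexE)
    from conjunct2[OF k2] obtain f where f: "f \<in> G"
      and f2: "map f (map e (Suc k # ms)) = b # map snd zs" by (rule bexE)
    have "p k = 0" using k k2 by simp
    with good have "\<exists>j. state (w j) (Suc k) = Suc k" by (simp only: good_def)
    then obtain j where j: "state (w j) (Suc k) = Suc k" by (rule exE)
    have st: "state (w i) (Suc k) = state (w i) t" if "i \<in> fst ` set zs" for i
    proof (rule state_stable[OF _ _ conjunct1[OF k2]])
      show "state (w i) t \<noteq> 0" using sep that unfolding separated_def by blast
      show "t \<le> k" using k by simp
    qed
    have sep': "separated w (fst ` set zs) (Suc k)"
      using separated_mono[OF sep] k by simp
    \<comment> \<open>The walks of \<open>zs\<close> have stood still since time \<open>t\<close>,
      at indices not above \<open>t\<close>, so none of them is the walk \<open>j\<close> that has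
      just entered at \<open>Suc k\<close>.\<close>
    have new: "state (w i) (Suc k) \<noteq> Suc k" if "i \<in> fst ` set zs" for i
      unfolding st[OF that] using state_le[of "w i" t] k by simp
    have "separated w (insert j (fst ` set zs)) (Suc k)"
      unfolding separated_def inj_on_insert
    proof (intro conjI ballI notI)
      show "inj_on (\<lambda>i. state (w i) (Suc k)) (fst ` set zs)" using sep' by (simp only: separated_def)
      show False if im: "state (w j) (Suc k) \<in> (\<lambda>i. state (w i) (Suc k)) ` (fst ` set zs - {j})"
      proof -
        obtain i where i: "i \<in> fst ` set zs" "state (w j) (Suc k) = state (w i) (Suc k)"
          using im by (auto simp del: state.simps)
        then show False using new[OF i(1)] i(2) j by (metis (no_types))
      qed
      show False if "i \<in> insert j (fst ` set zs)" "state (w i) (Suc k) = 0" for i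
      proof (cases "i = j")
        case True
        then show False using that(2) j by (simp only: nat.distinct)
      next
        case False
        then have "i \<in> fst ` set zs" using that(1) by simp
        then show False using sep' that(2) unfolding separated_def by blast
      qed
    qed
    then have "separated w (fst ` set ((j, b) # zs)) (Suc k)" by simp
    moreover have "\<forall>z\<in>set ((j, b) # zs). f (e (state (w (fst z)) (Suc k))) = snd z"
    proof
      fix z assume "z \<in> set ((j, b) # zs)"
      then consider "z = (j, b)" | "z \<in> set zs" by auto
      then show "f (e (state (w (fst z)) (Suc k))) = snd z"
      proof cases
        case 1
        then show ?thesis using f2 by (simp only: j fst_conv snd_conv list.map list.inject)
      next
        case 2
        then have "f (e (state (w (fst z)) t)) = snd z" using f2 unfolding ms_def by simp
        then show ?thesis by (simp only: st[OF imageI[OF 2]])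
      qed
    qed
    ultimately have "T ((j, b) # zs)" by (rule T_I[OF _ f])
    then show "\<exists>a. T ((a, b) # zs)" by blast
  next
    fix zs :: "(nat \<times> nat) list" and a b a' b'
    assume "T zs" and ab: "(a, b) \<in> set zs" "(a', b') \<in> set zs"
    then obtain n u where n: "separated w (fst ` set zs) n" and u: "u \<in> G"
      and z: "\<forall>z\<in>set zs. u (e (state (w (fst z)) n)) = snd z"
      unfolding T_def by (elim exE conjE) (rule that)
    have I: "a \<in> fst ` set zs" "a' \<in> fst ` set zs" using ab by force+
    have "b = b' \<longleftrightarrow> u (e (state (w a) n)) = u (e (state (w a') n))"
      using bspec[OF z ab(1)] bspec[OF z ab(2)] by simp
    also have "\<dots> \<longleftrightarrow> e (state (w a) n) = e (state (w a') n)" by (rule G_eq_iff[OF u])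
    also have "\<dots> \<longleftrightarrow> state (w a) n = state (w a') n"
      using n I unfolding separated_def by (intro e_eq_iff) blast+
    also have "\<dots> \<longleftrightarrow> a = a'"
      using n inj_on_eq_iff[of "\<lambda>i. state (w i) n", OF _ I] by (simp only: separated_def)
    finally show "a = a' \<longleftrightarrow> b = b'" by simp
  next
    fix h :: "nat \<Rightarrow> nat"
    assume "bij h" "\<And>F. finite F \<Longrightarrow> \<exists>zs. T zs \<and> (\<forall>a\<in>F. (a, h a) \<in> set zs)"
    then show thesis by (rule that)
  qed
  have "\<forall>\<^sub>F n in sequentially. \<exists>u\<in>G. \<forall>i\<in>F. u (e (state (w i) n)) = h i" if "finite F" for F
  proof -
    obtain zs where zs: "T zs" "\<forall>a\<in>F. (a, h a) \<in> set zs" using hT[OF \<open>finite F\<close>] by blast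
    then obtain n u where n: "separated w (fst ` set zs) n" and u: "u \<in> G"
      and z: "\<forall>z\<in>set zs. u (e (state (w (fst z)) n)) = snd z"
      unfolding T_def by (elim exE conjE) (rule that)
    have "\<exists>u\<in>G. \<forall>i\<in>F. u (e (state (w i) n')) = h i" if "n \<le> n'" for n'
    proof -
      obtain v where v: "v \<in> G" and vz: "\<forall>z\<in>set zs. v (e (state (w (fst z)) n')) = snd z"
        using T_later[OF n \<open>n \<le> n'\<close> u z] by (rule bexE)
      have "v (e (state (w i) n')) = h i" if "i \<in> F" for i
        using bspec[OF vz bspec[OF zs(2) that]] by simp
      then show ?thesis using v by (intro bexI[of _ v] ballI)
    qed
    then show ?thesis unfolding eventually_sequentially by (intro exI[of _ n] allI impI)
  qed
  then have "limit_bij w h" using h unfolding limit_bij_def by (intro conjI allI impI)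
  then show ?thesis by (intro exI[of _ h])
qed

lemma limit_bij_invariant:
  assumes h: "limit_bij w h" and Q: "\<And>u xs. u \<in> G \<Longrightarrow> Q (map u xs) = Q xs"
  shows "\<forall>\<^sub>F n in sequentially. Q (map (\<lambda>i. e (state (w i) n)) ns) = Q (map h ns)"
proof -
  have "\<forall>\<^sub>F n in sequentially. \<exists>u\<in>G. \<forall>i\<in>set ns. u (e (state (w i) n)) = h i"
    using h by (simp add: limit_bij_def)
  then show ?thesis
  proof eventually_elim
    case (elim n)
    then obtain u where u: "u \<in> G" and u2: "\<forall>i\<in>set ns. u (e (state (w i) n)) = h i" by (rule bexE)
    have eq: "map h ns = map u (map (\<lambda>i. e (state (w i) n)) ns)" using u2 by simp
    show ?case unfolding eq by (rule Q[OF u, symmetric])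
  qed
qed

text \<open>The right-hand side does not mention \<open>h\<close>. Hence invariant predicates of the
  limit are determined by \<open>w\<close>, and measurable, although \<open>h\<close> itself is an
  arbitrary choice.\<close>

lemma limit_bij_invariant_iff:
  assumes h: "limit_bij w h" and Q: "\<And>u xs. u \<in> G \<Longrightarrow> Q (map u xs) = Q xs"
  shows "Q (map h ns) \<longleftrightarrow> (\<forall>\<^sub>F n in sequentially. Q (map (\<lambda>i. e (state (w i) n)) ns))"
proof -
  have "(\<forall>\<^sub>F n in sequentially. Q (map (\<lambda>i. e (state (w i) n)) ns)) \<longleftrightarrow>
      (\<forall>\<^sub>F n :: nat in sequentially. Q (map h ns))"
    by (rule eventually_subst) (rule limit_bij_invariant[where Q = Q, OF h Q])
  also have "\<dots> \<longleftrightarrow> Q (map h ns)" by (rule eventually_const[OF sequentially_bot])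
  finally show ?thesis by (rule sym)
qed

lemma limit_bij_reindex:
  assumes "limit_bij w h" "bij g"
  shows "limit_bij (w \<circ> g) (h \<circ> g)"
  unfolding limit_bij_def
proof (intro conjI allI impI)
  show "bij (h \<circ> g)" using assms bij_comp[OF assms(2), of h] by (simp only: limit_bij_def)
  fix F :: "nat set" assume "finite F"
  then have "\<forall>\<^sub>F n in sequentially. \<exists>u\<in>G. \<forall>i\<in>g ` F. u (e (state (w i) n)) = h i"
    using assms(1) unfolding limit_bij_def by blast
  then show "\<forall>\<^sub>F n in sequentially. \<exists>u\<in>G. \<forall>i\<in>F. u (e (state ((w \<circ> g) i) n)) = (h \<circ> g) i"
  proof (rule eventually_mono)
    fix n assume "\<exists>u\<in>G. \<forall>i\<in>g ` F. u (e (state (w i) n)) = h i"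
    then obtain u where u: "u \<in> G" and u2: "\<forall>i\<in>g ` F. u (e (state (w i) n)) = h i" by (rule bexE)
    have "\<forall>i\<in>F. u (e (state ((w \<circ> g) i) n)) = (h \<circ> g) i" using u2 by simp
    then show "\<exists>u\<in>G. \<forall>i\<in>F. u (e (state ((w \<circ> g) i) n)) = (h \<circ> g) i" using u by (rule bexI)
  qed
qed

lemma good_reindex:
  assumes "good w" "bij g"
  shows "good (w \<circ> g)"
proof -
  have ij: "g i \<noteq> g j" if "i \<noteq> j" for i j
    using inj_eq[OF bij_is_inj[OF assms(2)], of i j] that by simp
  note good = assms(1)[unfolded good_def]
  show ?thesis
    unfolding good_def comp_apply
  proof (intro conjI allI impI)
    fix i j :: nat assume "i \<noteq> j"
    then show "\<exists>n. state (w (g i)) n \<noteq> state (w (g j)) n" using good ij by blast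
  next
    fix i show "\<exists>n. state (w (g i)) n \<noteq> 0" using good by blast
  next
    fix n assume "p n = 0"
    then obtain j where j: "state (w j) (Suc n) = Suc n" using good by blast
    have "g (inv g j) = j" using assms(2) by (simp add: bij_is_surj surj_f_inv_f)
    then show "\<exists>j. state (w (g j)) (Suc n) = Suc n" using j by (intro exI[of _ "inv g j"]) (simp only:)
  qed
qed

end

section \<open>Infinite products\<close>

text \<open>By independence, staying in \<open>B n\<close> on \<open>m\<close> coordinates of
  \<open>S\<close> has probability at most \<open>r ^ m\<close>, for every \<open>m\<close>. It is
  applied to coordinates that are times of one walk and to coordinates that are walks.\<close>

lemma AE_PiM_escape:
  fixes B :: "nat \<Rightarrow> 'a set"
  assumes K: "prob_space K" and B: "\<And>n. B n \<in> sets K" and S: "infinite S"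
    and le: "\<And>n. n \<in> S \<Longrightarrow> measure K (B n) \<le> r" and r: "r < 1"
  shows "AE y in PiM UNIV (\<lambda>_. K). \<exists>n\<in>S. y n \<notin> B n"
proof -
  let ?P = "PiM UNIV (\<lambda>_::nat. K)"
  interpret product_prob_space "\<lambda>_. K" "UNIV :: nat set"
    using K by (intro product_prob_spaceI)
  let ?E = "{y \<in> space ?P. \<forall>n\<in>S. y n \<in> B n}"
  have [measurable]: "Measurable.pred K (\<lambda>x. x \<in> B n)" for n using B by simp
  have E: "?E \<in> sets ?P" by measurable
  obtain n0 where "n0 \<in> S" using S by fastforce
  then have r0: "0 \<le> r" using le[of n0] measure_nonneg[of K "B n0"] by linarith
  have "measure ?P ?E \<le> r ^ m" for m
  proof -
    obtain J where J: "J \<subseteq> S" "finite J" "card J = m"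
      using infinite_arbitrarily_large[OF S] by blast
    have "measure ?P ?E \<le> measure ?P (emb UNIV J (Pi\<^sub>E J B))"
    proof (rule finite_measure_mono)
      show "?E \<subseteq> emb UNIV J (Pi\<^sub>E J B)"
        using J(1) by (auto simp: prod_emb_def space_PiM) blast
      show "emb UNIV J (Pi\<^sub>E J B) \<in> sets ?P"
        by (rule sets_PiM_I) (use J B in auto)
    qed
    also have "\<dots> = (\<Prod>j\<in>J. measure K (B j))"
      using J B by (intro measure_PiM_emb) auto
    also have "\<dots> \<le> (\<Prod>j\<in>J. r)"
      using J le by (intro prod_mono) (auto simp: measure_nonneg)
    finally show ?thesis using J by simp
  qed
  moreover have "(\<lambda>m. r ^ m) \<longlonglongrightarrow> 0" using r r0 by (intro LIMSEQ_power_zero) simp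
  ultimately have "measure ?P ?E \<le> 0" by (intro LIMSEQ_le_const[of "\<lambda>m. r ^ m"]) auto
  then have "emeasure ?P ?E = 0" by (simp add: emeasure_eq_measure measure_le_0_iff)
  then show ?thesis using E by (intro AE_I[of _ _ ?E]) auto
qed

text \<open>Two distinct coordinates are independent with joint law
  \<open>K \<Otimes>\<^sub>M K\<close>; the product measure then reduces the claim to a statement
  with the first coordinate held fixed.\<close>

lemma AE_PiM_pair:
  fixes i j :: "'i"
  assumes K: "prob_space K" and ij: "i \<noteq> j"
    and meas: "{x \<in> space (K \<Otimes>\<^sub>M K). R (fst x) (snd x)} \<in> sets (K \<Otimes>\<^sub>M K)"
    and ae: "AE y in K. AE z in K. R y z"
  shows "AE w in PiM UNIV (\<lambda>_. K). R (w i) (w j)"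
proof -
  let ?P = "PiM UNIV (\<lambda>_::'i. K)" and ?f = "\<lambda>b. if b then i else j"
  interpret K: prob_space K by (rule K)
  interpret KK: pair_prob_space K K ..
  interpret P: prob_space ?P using K by (intro prob_space_PiM)
  have "distr ?P (PiM UNIV (\<lambda>_::bool. K)) (\<lambda>w. \<lambda>b\<in>UNIV. w (?f b)) = PiM UNIV (\<lambda>_::bool. K)"
    using K ij by (intro distr_PiM_reindex) (auto simp: inj_on_def)
  moreover have dc: "distr ?P K (\<lambda>w. w k) = K" for k
    using K by (intro distr_PiM_component) auto
  ultimately have indep: "P.indep_vars (\<lambda>_::bool. K) (\<lambda>b w. w (?f b)) UNIV"
    by (subst P.indep_vars_iff_distr_eq_PiM') auto
  have "(\<lambda>_::bool. K) = case_bool K K" "(\<lambda>b w. w (?f b)) = case_bool (\<lambda>w. w i) (\<lambda>w. w j)"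
    by (auto simp: fun_eq_iff split: bool.split)
  from indep[unfolded this] have "P.indep_var K (\<lambda>w. w i) K (\<lambda>w. w j)"
    unfolding P.indep_var_def .
  then have eq: "K \<Otimes>\<^sub>M K = distr ?P (K \<Otimes>\<^sub>M K) (\<lambda>w. (w i, w j))"
    unfolding P.indep_var_distribution_eq by (simp add: dc)
  have "AE x in K \<Otimes>\<^sub>M K. R (fst x) (snd x)"
    using meas ae by (intro KK.AE_pair_measure) auto
  then have "AE x in distr ?P (K \<Otimes>\<^sub>M K) (\<lambda>w. (w i, w j)). R (fst x) (snd x)"
    by (simp only: eq[symmetric])
  from AE_distrD[OF _ this] show ?thesis by simp
qed

lemma distr_PiM_bij:
  fixes g :: "'i \<Rightarrow> 'i"
  assumes K: "prob_space K" and g: "bij g"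
  shows "distr (PiM UNIV (\<lambda>_. K)) (PiM UNIV (\<lambda>_. K)) (\<lambda>w. w \<circ> g) = PiM UNIV (\<lambda>_. K)"
  using distr_PiM_reindex[of UNIV "\<lambda>_. K" g UNIV] K g
  by (simp add: bij_is_inj comp_def restrict_UNIV)

lemma pred_eq_nat:
  fixes g h :: "'a \<Rightarrow> nat"
  assumes [measurable]: "g \<in> P \<rightarrow>\<^sub>M count_space UNIV" "h \<in> P \<rightarrow>\<^sub>M count_space UNIV"
  shows "Measurable.pred P (\<lambda>x. g x = h x)"
proof -
  have "Measurable.pred P (\<lambda>x. \<exists>m. h x = m \<and> g x = m)" by measurable
  then show ?thesis by simp
qed

lemma sets_pair_differ:
  fixes f :: "nat \<Rightarrow> 'a \<Rightarrow> nat"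
  assumes f: "\<And>n. f n \<in> K \<rightarrow>\<^sub>M count_space UNIV"
  shows "{x \<in> space (K \<Otimes>\<^sub>M K). \<exists>n. f n (fst x) \<noteq> f n (snd x)} \<in> sets (K \<Otimes>\<^sub>M K)"
proof -
  have "Measurable.pred (K \<Otimes>\<^sub>M K) (\<lambda>x. \<exists>n. f n (fst x) \<noteq> f n (snd x))"
    by (intro pred_intros_countable pred_intros_logic pred_eq_nat measurable_compose[OF measurable_fst f]
        measurable_compose[OF measurable_snd f])
  then show ?thesis unfolding pred_def .
qed

lemma pred_states:
  fixes f :: "'i \<Rightarrow> 'a \<Rightarrow> nat"
  assumes [measurable]: "\<And>i. f i \<in> P \<rightarrow>\<^sub>M count_space UNIV"
  shows "Measurable.pred P (\<lambda>w. \<exists>ms\<in>A. \<forall>k<m. f (ns ! k) w = ms ! k)"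
  by measurable

section \<open>Coin flips and independent samples\<close>

abbreviation coin :: "bool measure" where
  "coin \<equiv> measure_pmf (bernoulli_pmf (1 / 2))"

abbreviation coins :: "(nat \<Rightarrow> bool) measure" where
  "coins \<equiv> PiM UNIV (\<lambda>_. coin)"

abbreviation samples :: "(nat \<Rightarrow> nat \<Rightarrow> bool) measure" where
  "samples \<equiv> PiM UNIV (\<lambda>_. coins)"

lemma prob_space_coin: "prob_space coin"
  by (rule measure_pmf.prob_space_axioms)

lemma prob_space_coins: "prob_space coins"
  by (intro prob_space_PiM prob_space_coin)

lemma prob_space_samples: "prob_space samples"
  by (intro prob_space_PiM prob_space_coins)

lemma measure_coin: "measure coin {c} = 1 / 2"
  by (cases c) (simp_all add: measure_pmf_single)

lemma coin_measurable [measurable]: "Measurable.pred coins (\<lambda>y. y n)"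
  by (rule measurable_compose[OF measurable_component_singleton[of n UNIV]]) auto

lemma AE_coins_differ:
  assumes "infinite S"
  shows "AE y in coins. \<exists>n\<in>S. y n \<noteq> c n"
  using AE_PiM_escape[OF prob_space_coin _ assms, of "\<lambda>n. {c n}" "1/2"]
  by (simp add: measure_coin)

section \<open>The invariant measure\<close>

context generic_sequence
begin

lemma state_measurable [measurable]: "(\<lambda>y. state y n) \<in> coins \<rightarrow>\<^sub>M count_space UNIV"
  by (induction n) simp_all

lemma AE_state_nonzero: "AE y in coins. \<exists>n. state y n \<noteq> 0"
  using AE_coins_differ[OF free_infinite, of "\<lambda>_. False"]
proof eventually_elim
  case (elim y)
  then obtain n where "p n = 0" "y n" by auto
  \<comment> \<open>With heads at a free step, a walk still in state \<open>0\<close> enters, and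
    one that has entered stays nonzero.\<close>
  then have "state y (Suc n) \<noteq> 0" by simp
  then show ?case by (rule exI)
qed

text \<open>For fixed \<open>y\<close>, the times at which the position of \<open>y\<close> is a
  parent form an infinite set not depending on \<open>z\<close>. If the coins differ at such a time
  and the walks are still together, exactly one of them moves.\<close>

lemma AE_state_differ: "AE z in coins. \<exists>n. state y n \<noteq> state z n"
  using AE_coins_differ[OF parent_state_infinite[of y], of y]
proof eventually_elim
  case (elim z)
  then obtain n where n: "p n = state y n" "z n \<noteq> y n" by auto
  show ?case
  proof (cases "state y n = state z n")
    case True
    then have "state y (Suc n) \<noteq> state z (Suc n)"
      using n state_le[of z n] by (cases "y n") auto
    then show ?thesis by (rule exI)
  qed (rule exI)
qed

lemma state_reached:
  assumes "p n = 0"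
  shows "measure coins {y \<in> space coins. state y (Suc n) = Suc n} > 0"
proof -
  interpret product_prob_space "\<lambda>_. coin" "UNIV :: nat set"
    using prob_space_coin by (intro product_prob_spaceI)
  \<comment> \<open>The coin pattern of tails before time \<open>n\<close> and heads at
    \<open>n\<close>: the walk stays in state \<open>0\<close> up to \<open>n\<close> and then
    enters at \<open>Suc n\<close>.\<close>
  let ?B = "\<lambda>i. {i = n}"
  have "0 < (\<Prod>i\<in>{..n}. measure coin (?B i))" by (simp add: measure_coin)
  also have "\<dots> = measure coins (emb UNIV {..n} (Pi\<^sub>E {..n} ?B))"
    by (rule measure_PiM_emb[symmetric]) auto
  also have "\<dots> \<le> measure coins {y \<in> space coins. state y (Suc n) = Suc n}"
  proof (rule finite_measure_mono)
    show "{y \<in> space coins. state y (Suc n) = Suc n} \<in> sets coins" by measurable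
    show "emb UNIV {..n} (Pi\<^sub>E {..n} ?B) \<subseteq> {y \<in> space coins. state y (Suc n) = Suc n}"
    proof
      fix y assume "y \<in> emb UNIV {..n} (Pi\<^sub>E {..n} ?B)"
      then have y: "\<forall>i\<le>n. y i = (i = n)" and sp: "y \<in> space coins"
        by (simp_all add: prod_emb_def PiE_iff space_PiM)
      have "m \<le> n \<longrightarrow> state y m = 0" for m
      proof (induction m)
        case (Suc m)
        have "\<not> y m" if "Suc m \<le> n" using y[rule_format, of m] that by simp
        then show ?case using Suc.IH by simp
      qed simp
      from this[of n] have "state y n = 0" by simp
      moreover have "y n" using y by simp
      ultimately show "y \<in> {y \<in> space coins. state y (Suc n) = Suc n}" using assms sp by simp
    qed
  qed
  finally show ?thesis .
qed

text \<open>Each of infinitely many independent walks enters here with the same positive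
  probability, so almost surely one of them does.\<close>

lemma AE_state_reached:
  assumes "p n = 0"
  shows "AE w in samples. \<exists>j. state (w j) (Suc n) = Suc n"
proof -
  interpret prob_space coins by (rule prob_space_coins)
  let ?A = "{y \<in> space coins. state y (Suc n) = Suc n}"
  have A: "?A \<in> sets coins" by measurable
  have "AE w in samples. \<exists>j\<in>UNIV. w j \<notin> space coins - ?A"
  proof (rule AE_PiM_escape[OF prob_space_coins])
    show "measure coins (space coins - ?A) \<le> 1 - measure coins ?A" for j :: nat
      using prob_compl[OF A] by simp
  qed (use A state_reached[OF assms] in auto)
  moreover have "AE w in samples. \<forall>j. w j \<in> space coins"
    by (rule AE_I2) (auto simp: space_PiM)
  ultimately show ?thesis by eventually_elim auto
qed

lemma AE_good: "AE w in samples. good w"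
proof -
  have "AE w in samples. i \<noteq> j \<longrightarrow> (\<exists>n. state (w i) n \<noteq> state (w j) n)" for i j
  proof (cases "i = j")
    case False
    have "AE w in samples. \<exists>n. state (w i) n \<noteq> state (w j) n"
    proof (rule AE_PiM_pair[OF prob_space_coins False])
      show "{x \<in> space (coins \<Otimes>\<^sub>M coins). \<exists>n. state (fst x) n \<noteq> state (snd x) n}
          \<in> sets (coins \<Otimes>\<^sub>M coins)"
        by (rule sets_pair_differ[OF state_measurable])
    qed (rule AE_I2, rule AE_state_differ)
    then show ?thesis by simp
  qed simp
  moreover have "AE w in samples. \<exists>n. state (w i) n \<noteq> 0" for i
    by (rule AE_PiM_component[OF prob_space_coins _ AE_state_nonzero]) simp
  moreover have "AE w in samples. p n = 0 \<longrightarrow> (\<exists>j. state (w j) (Suc n) = Suc n)" for n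
  proof (cases "p n = 0")
    case True
    then show ?thesis using AE_state_reached[OF True] by (simp only: simp_thms)
  qed simp
  ultimately show ?thesis unfolding good_def by (simp only: AE_all_countable AE_conj_iff simp_thms)
qed

lemma sample_state_measurable:
  "(\<lambda>w. state (w i) n) \<in> samples \<rightarrow>\<^sub>M count_space UNIV"
  by (rule measurable_compose[OF measurable_component_singleton[of i UNIV "\<lambda>_. coins"]
      state_measurable]) simp

lemma good_measurable [measurable]: "Measurable.pred samples good"
  unfolding good_def
  by (intro pred_intros_logic pred_intros_countable pred_eq_nat sample_state_measurable
      measurable_const) simp_all

text \<open>\<open>Q\<close> is arbitrary: the positions form a list of numbers, so the event is a
  countable union over the possible lists.\<close>

lemma states_measurable:
  "Measurable.pred samples (\<lambda>w. Q (map (\<lambda>i. e (state (w i) n)) ns))"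
proof -
  have "Q (map (\<lambda>i. e (state (w i) n)) ns) \<longleftrightarrow>
      (\<exists>ms\<in>{ms. Q (map e ms) \<and> length ms = length ns}.
        \<forall>k<length ns. state (w (ns ! k)) n = ms ! k)" (is "?l \<longleftrightarrow> ?r") for w
  proof
    let ?ms = "map (\<lambda>i. state (w i) n) ns"
    have "map (\<lambda>i. e (state (w i) n)) ns = map e ?ms" by simp
    moreover assume ?l
    ultimately have "Q (map e ?ms)" by (simp only:)
    then have "?ms \<in> {ms. Q (map e ms) \<and> length ms = length ns}" by simp
    moreover have "\<forall>k<length ns. state (w (ns ! k)) n = ?ms ! k" by simp
    ultimately show ?r by (rule bexI[rotated])
  next
    assume ?r
    then obtain ms where ms: "ms \<in> {ms. Q (map e ms) \<and> length ms = length ns}"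
      "\<forall>k<length ns. state (w (ns ! k)) n = ms ! k" by (rule bexE)
    have "map (\<lambda>i. e (state (w i) n)) ns = map e ms"
      using ms by (intro nth_equalityI) simp_all
    then show ?l using ms(1) by simp
  qed
  moreover have "Measurable.pred samples (\<lambda>w. \<exists>ms\<in>{ms. Q (map e ms) \<and> length ms = length ns}.
        \<forall>k<length ns. state (w (ns ! k)) n = ms ! k)"
    using pred_states[of "\<lambda>i w. state (w i) n" samples, OF sample_state_measurable] .
  ultimately show ?thesis by (simp only:)
qed

text \<open>The default \<open>id\<close> makes this a bijection for every \<open>w\<close>, so the
  pulled back structure is isomorphic to \<open>M\<close> even off the almost sure event.\<close>

definition limit_map :: "(nat \<Rightarrow> nat \<Rightarrow> bool) \<Rightarrow> nat \<Rightarrow> nat" where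
  "limit_map w = (if good w then SOME h. limit_bij w h else id)"

lemma limit_map: "good w \<Longrightarrow> limit_bij w (limit_map w)"
  unfolding limit_map_def using someI_ex[OF good_limit_bij] by simp

lemma bij_limit_map: "bij (limit_map w)"
  using limit_map by (cases "good w") (auto simp: limit_bij_def limit_map_def)

lemma limit_map_measurable:
  assumes Q: "\<And>u xs. u \<in> G \<Longrightarrow> Q (map u xs) = Q xs"
  shows "Measurable.pred samples (\<lambda>w. Q (map (limit_map w) ns))"
proof -
  have "Q (map (limit_map w) ns) \<longleftrightarrow>
      (if good w then \<forall>\<^sub>F n in sequentially. Q (map (\<lambda>i. e (state (w i) n)) ns) else Q ns)" for w
  proof (cases "good w")
    case True
    then show ?thesis
      using limit_bij_invariant_iff[where Q = Q, OF limit_map[OF True] Q] by (simp only: if_True)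
  qed (simp add: limit_map_def)
  moreover have "Measurable.pred samples (\<lambda>w. if good w
      then \<forall>\<^sub>F n in sequentially. Q (map (\<lambda>i. e (state (w i) n)) ns) else Q ns)"
    unfolding eventually_sequentially
    using states_measurable[of Q _ ns, measurable] by measurable
  ultimately show ?thesis by (simp only:)
qed

end

section \<open>The random structure and its law\<close>

lemma trivial_dcl_group_automorphisms:
  assumes M: "M \<in> nat_structures L" and dcl: "trivial_definable_closure L M"
  shows "trivial_dcl_group {u. automorphism L M u}"
proof
  have st: "is_structure L M" and u: "universe M = UNIV" using M by (simp_all add: nat_structures_def)
  show "bij u" if "u \<in> {u. automorphism L M u}" for u
    using isomorphism_bij[OF M M] that by simp
  show "id \<in> {u. automorphism L M u}" by (simp add: isomorphism_id)
  show "u \<circ> v \<in> {u. automorphism L M u}"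
    if "u \<in> {u. automorphism L M u}" "v \<in> {u. automorphism L M u}" for u v
    using isomorphism_comp[of L M M v M u] that by simp
  show "inv u \<in> {u. automorphism L M u}" if "u \<in> {u. automorphism L M u}" for u
    using isomorphism_inv_into[OF st, of M u] that by (simp add: u)
  fix F :: "nat set" and d assume "finite F" "d \<notin> F"
  then obtain as where as: "set as = F" using finite_list by blast
  have "definable_closure L M as = F"
    using dcl as by (simp add: trivial_definable_closure_def u)
  then have "d \<notin> definable_closure L M as" using \<open>d \<notin> F\<close> by simp
  then obtain h where "automorphism L M h" "\<forall>a\<in>set as. h a = a" "h d \<noteq> d"
    unfolding definable_closure_def u by blast
  then show "\<exists>u\<in>{u. automorphism L M u}. (\<forall>a\<in>F. u a = a) \<and> u d \<noteq> d"
    using as by (intro bexI[of _ h]) simp_all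
qed

lemma exists_invariant_measure_nat:
  fixes L :: "('r, 'c, 'f) language"
  assumes L: "countable_language L" and M: "M \<in> nat_structures L"
    and dcl: "trivial_definable_closure L M"
  shows "\<exists>\<mu> :: ('r, 'c, 'f, nat) interpretation_data measure.
    sets \<mu> = sets (structure_space L) \<and> prob_space \<mu> \<and>
    invariant_measure L \<mu> \<and> concentrated_on L \<mu> M"
proof -
  define G where "G = {u. automorphism L M u}"
  interpret trivial_dcl_group G
    unfolding G_def by (rule trivial_dcl_group_automorphisms[OF M dcl])
  obtain e p where "\<And>n. valid n e p" "\<And>q N. \<exists>k\<ge>N. p k = q"
    "\<And>N b d. d \<notin> set b \<Longrightarrow> \<exists>n. has_witnesses N b d n e p"
    using exists_generic_sequence by blast
  then interpret generic_sequence G e p by unfold_locales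
  have UM: "universe M = UNIV" using M by (simp add: nat_structures_def)
  have "is_structure L M" using M by (simp add: nat_structures_def)
  note relD = conjunct1[OF this[unfolded is_structure_def UM], rule_format, THEN conjunct2]
  have auto: "isomorphism L M M u" if "u \<in> G" for u using that by (simp add: G_def)
  have Q_rel: "rel_of M R (map u ns) = rel_of M R ns"
    if "R \<in> rel_symbols L" "u \<in> G" for R u ns
  proof (cases "ns \<in> tuples UNIV (rel_arity L R)")
    case True
    then have "rel_of M R ns = rel_of M R (map u ns)"
      by (intro isomorphismD(1)[OF auto[OF that(2)] that(1)]) (simp only: UM)
    then show ?thesis by (rule sym)
  next
    case False
    \<comment> \<open>On lists of the wrong length both sides are \<open>False\<close>, because
      \<open>M\<close> is extensional.\<close>
    then show ?thesis using relD[of R ns] relD[of R "map u ns"] by (simp only: map_in_tuples_UNIV) blast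
  qed
  have Q_const: "const_of M c = hd (map u ns) \<longleftrightarrow> const_of M c = hd ns"
    if "c \<in> const_symbols L" "u \<in> G" "ns \<noteq> []" for c u and ns :: "nat list"
  proof -
    have "u (const_of M c) = const_of M c"
      by (rule isomorphismD(2)[OF auto[OF that(2)] that(1)])
    then show ?thesis using G_eq_iff[OF that(2), of "const_of M c" "hd ns"] that(3) by (simp add: hd_map)
  qed
  have Q_fun: "fun_of M f (tl (map u ns)) = hd (map u ns) \<longleftrightarrow> fun_of M f (tl ns) = hd ns"
    if "f \<in> fun_symbols L" "u \<in> G" "ns \<noteq> []" "tl ns \<in> tuples UNIV (fun_arity L f)" for f u ns
  proof -
    have "u (fun_of M f (tl ns)) = fun_of M f (map u (tl ns))"
      by (rule isomorphismD(3)[OF auto[OF that(2)] that(1)]) (simp add: UM that(4))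
    then show ?thesis
      using G_eq_iff[OF that(2), of "fun_of M f (tl ns)" "hd ns"] that(3) by (simp add: hd_map map_tl)
  qed
  \<comment> \<open>Function values are put at the head of the argument list, so that each atomic formula becomes
    a \<open>G\<close>-invariant predicate of lists.\<close>
  let ?Qc = "\<lambda>c ns. ns \<noteq> [] \<and> const_of M c = hd ns"
  let ?Qf = "\<lambda>f ns. ns \<noteq> [] \<and> tl ns \<in> tuples UNIV (fun_arity L f) \<and> fun_of M f (tl ns) = hd ns"
  have Qc: "?Qc c (map u ns) = ?Qc c ns" if "c \<in> const_symbols L" "u \<in> G" for c u ns
  proof (cases "ns = []")
    case False
    show ?thesis using Q_const[OF that False] by (simp only: map_is_Nil_conv)
  qed simp
  have Qf: "?Qf f (map u ns) = ?Qf f ns" if "f \<in> fun_symbols L" "u \<in> G" for f u ns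
  proof (cases "ns \<noteq> [] \<and> tl ns \<in> tuples UNIV (fun_arity L f)")
    case True
    then show ?thesis
      using Q_fun[OF that conjunct1[OF True] conjunct2[OF True]]
      by (simp only: map_is_Nil_conv map_tl[symmetric] map_in_tuples_UNIV simp_thms)
  next
    case False
    then show ?thesis by (simp only: map_is_Nil_conv map_tl[symmetric] map_in_tuples_UNIV) blast
  qed
  \<comment> \<open>The structure on the natural numbers that makes \<open>h\<close> an isomorphism
    onto \<open>M\<close> when \<open>h\<close> is a bijection; it depends on \<open>h\<close> only
    through invariant predicates.\<close>
  define pull where "pull h = logic_action L (inv h) M" for h
  have pull_in: "pull h \<in> nat_structures L" for h
    unfolding pull_def by (rule logic_action_in_nat_structures[OF M])
  have pull_rel: "rel_of (pull h) R ns = rel_of M R (map h ns)" if "bij h" for h R ns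
    using that by (simp add: pull_def inv_inv_eq)
  have inv_eq: "inv h x = l \<longleftrightarrow> x = h l" if "bij h" for h :: "nat \<Rightarrow> nat" and x l
    using bij_inv_eq_iff[OF that, of l x] by (simp only: eq_commute)
  have pull_const: "const_of (pull h) c = l \<longleftrightarrow> ?Qc c (map h [l])"
    if "bij h" "c \<in> const_symbols L" for h c l
    using that by (simp add: pull_def inv_eq)
  have pull_fun: "fun_of (pull h) f ns = l \<longleftrightarrow> ?Qf f (map h (l # ns))"
    if "bij h" "f \<in> fun_symbols L" "ns \<in> tuples UNIV (fun_arity L f)" for h f ns l
    using that by (simp add: pull_def inv_eq inv_inv_eq)
  define \<Phi> where "\<Phi> w = pull (limit_map w)" for w
  interpret S: prob_space samples by (rule prob_space_samples)
  have \<Phi>[measurable]: "\<Phi> \<in> samples \<rightarrow>\<^sub>M structure_space L"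
  proof (rule measurable_structure_space)
    show "Measurable.pred samples (\<lambda>w. rel_of (\<Phi> w) R ns)" if "R \<in> rel_symbols L" for R ns
      unfolding \<Phi>_def pull_rel[OF bij_limit_map]
      by (rule limit_map_measurable[of "rel_of M R"]) (rule Q_rel[OF that])
    show "Measurable.pred samples (\<lambda>w. const_of (\<Phi> w) c = l)" if "c \<in> const_symbols L" for c l
      unfolding \<Phi>_def pull_const[OF bij_limit_map that]
      by (rule limit_map_measurable[of "?Qc c"]) (rule Qc[OF that])
    show "Measurable.pred samples (\<lambda>w. fun_of (\<Phi> w) f ns = l)"
      if "f \<in> fun_symbols L" "ns \<in> tuples UNIV (fun_arity L f)" for f ns l
      unfolding \<Phi>_def pull_fun[OF bij_limit_map that]
      by (rule limit_map_measurable[of "?Qf f"]) (rule Qf[OF that(1)])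
  qed (simp add: \<Phi>_def pull_in)
  have pull_unique: "pull h = pull h'" if h: "limit_bij w h" "limit_bij w h'" for w h h'
  proof (rule nat_structures_eqI[OF pull_in pull_in])
    have b: "bij h" "bij h'" using h by (simp_all add: limit_bij_def)
    have same: "Q (map h ns) = Q (map h' ns)" if "\<And>u xs. u \<in> G \<Longrightarrow> Q (map u xs) = Q xs"
      for Q :: "nat list \<Rightarrow> bool" and ns
      using limit_bij_invariant_iff[where Q = Q, OF h(1) that]
        limit_bij_invariant_iff[where Q = Q, OF h(2) that] by (simp only:)
    show "rel_of (pull h) R ns = rel_of (pull h') R ns" if "R \<in> rel_symbols L" for R ns
      unfolding pull_rel[OF b(1)] pull_rel[OF b(2)]
      by (rule same[of "rel_of M R"]) (rule Q_rel[OF that])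
    \<comment> \<open>The equation is read as \<open>const_of (pull h) c = l\<close> with
      \<open>l\<close> the value in \<open>pull h'\<close>. It thus becomes an invariant predicate
      of \<open>map h [l]\<close>, which may be exchanged for \<open>map h' [l]\<close>. Function
      values are treated alike.\<close>
    show "const_of (pull h) c = const_of (pull h') c" if c: "c \<in> const_symbols L" for c
      unfolding pull_const[OF b(1) c]
      by (rule iffD2[OF same[of "?Qc c"]], erule Qc[OF c])
        (rule pull_const[OF b(2) c, THEN iffD1, OF refl])
    show "fun_of (pull h) f ns = fun_of (pull h') f ns"
      if f: "f \<in> fun_symbols L" "ns \<in> tuples UNIV (fun_arity L f)" for f ns
      unfolding pull_fun[OF b(1) f]
      by (rule iffD2[OF same[of "?Qf f"]], erule Qf[OF f(1)])
        (rule pull_fun[OF b(2) f, THEN iffD1, OF refl])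
  qed
  \<comment> \<open>The bijections chosen for \<open>w \<circ> g\<close> and for \<open>w\<close>
    need not be related, but \<open>limit_map w \<circ> g\<close> is also a limit for
    \<open>w \<circ> g\<close>, and all limits pull back to the same structure.\<close>
  have \<Phi>_reindex: "\<Phi> (w \<circ> g) = logic_action L (inv g) (\<Phi> w)" if w: "good w" and g: "bij g" for w g
  proof -
    have "\<Phi> (w \<circ> g) = pull (limit_map w \<circ> g)"
      unfolding \<Phi>_def
      by (rule pull_unique[OF limit_map[OF good_reindex[OF w g]] limit_bij_reindex[OF limit_map[OF w] g]])
    also have "\<dots> = logic_action L (inv g \<circ> inv (limit_map w)) M"
      unfolding pull_def using g bij_limit_map by (simp add: o_inv_distrib)
    also have "\<dots> = logic_action L (inv g) (\<Phi> w)"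
      unfolding \<Phi>_def pull_def
      using M g bij_limit_map by (intro logic_action_comp[symmetric] bij_imp_bij_inv)
    finally show ?thesis .
  qed
  define \<mu> where "\<mu> = distr samples (structure_space L) \<Phi>"
  have sets: "sets \<mu> = sets (structure_space L)" by (simp add: \<mu>_def)
  have em: "emeasure \<mu> A = emeasure samples {w \<in> space samples. \<Phi> w \<in> A}"
    if "A \<in> sets (structure_space L)" for A
    unfolding \<mu>_def using that
    by (subst emeasure_distr) (auto intro!: arg_cong[where f = "emeasure samples"])
  have "prob_space \<mu>" unfolding \<mu>_def by (rule S.prob_space_distr[OF \<Phi>])
  moreover have "invariant_measure L \<mu>"
    unfolding invariant_measure_def sets
  proof (intro allI impI ballI)
    fix g :: "nat \<Rightarrow> nat" and A assume g: "bij g" and A: "A \<in> sets (structure_space L)"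
    have sub: "A \<subseteq> nat_structures L" using sets.sets_into_space[OF A] by simp
    have gA: "logic_action L g ` A = logic_action L (inv g) -` A \<inter> space (structure_space L)"
      using logic_action_image[OF sub g] by simp
    have gA': "logic_action L g ` A \<in> sets (structure_space L)"
      unfolding gA by (rule measurable_sets[OF measurable_logic_action[OF bij_imp_bij_inv[OF g]] A])
    have reidx: "(\<lambda>w. w \<circ> g) \<in> samples \<rightarrow>\<^sub>M samples"
      by (rule measurable_PiM_single') (auto simp: space_PiM)
    have "emeasure \<mu> (logic_action L g ` A) =
        emeasure samples {w \<in> space samples. \<Phi> w \<in> logic_action L g ` A}" by (rule em[OF gA'])
    \<comment> \<open>Membership of \<open>\<Phi> w\<close> in the image of \<open>A\<close> means
      that the action of \<open>inv g\<close> brings it into \<open>A\<close>; for good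
      \<open>w\<close> this is \<open>\<Phi> (w \<circ> g) \<in> A\<close>. The two events may
      differ on the null set of bad \<open>w\<close>.\<close>
    also have "\<dots> = emeasure samples {w \<in> space samples. \<Phi> (w \<circ> g) \<in> A}"
    proof (rule emeasure_eq_AE)
      show "AE w in samples. w \<in> {w \<in> space samples. \<Phi> w \<in> logic_action L g ` A} \<longleftrightarrow>
          w \<in> {w \<in> space samples. \<Phi> (w \<circ> g) \<in> A}"
        using AE_good
      proof eventually_elim
        case (elim w)
        show ?case unfolding gA using \<Phi>_reindex[OF elim g] pull_in by (simp add: \<Phi>_def)
      qed
      show "{w \<in> space samples. \<Phi> w \<in> logic_action L g ` A} \<in> sets samples"
        using measurable_sets[OF \<Phi> gA'] by (simp add: vimage_def Int_def conj_commute)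
      show "{w \<in> space samples. \<Phi> (w \<circ> g) \<in> A} \<in> sets samples"
        using measurable_sets[OF measurable_compose[OF reidx \<Phi>] A]
        by (simp add: vimage_def Int_def conj_commute)
    qed
    also have "\<dots> = emeasure (distr samples samples (\<lambda>w. w \<circ> g)) {w \<in> space samples. \<Phi> w \<in> A}"
    proof (subst emeasure_distr[OF reidx])
      show "{w \<in> space samples. \<Phi> w \<in> A} \<in> sets samples"
        using measurable_sets[OF \<Phi> A] by (simp add: vimage_def Int_def conj_commute)
      show "emeasure samples {w \<in> space samples. \<Phi> (w \<circ> g) \<in> A} =
          emeasure samples ((\<lambda>w. w \<circ> g) -` {w \<in> space samples. \<Phi> w \<in> A} \<inter> space samples)"
        using measurable_space[OF reidx] by (intro arg_cong[where f = "emeasure samples"]) auto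
    qed
    also have "\<dots> = emeasure samples {w \<in> space samples. \<Phi> w \<in> A}"
      by (simp only: distr_PiM_bij[OF prob_space_coins g])
    also have "\<dots> = emeasure \<mu> A" by (rule em[OF A, symmetric])
    finally show "emeasure \<mu> (logic_action L g ` A) = emeasure \<mu> A" .
  qed
  moreover have "concentrated_on L \<mu> M"
  proof -
    let ?C = "{N \<in> nat_structures L. isomorphic L N M}"
    have "isomorphic L (\<Phi> w) M" for w
    proof -
      have "isomorphism L (\<Phi> w) M (inv_into UNIV (inv (limit_map w)))"
        using isomorphism_inv_into[of L M "\<Phi> w" "inv (limit_map w)"] M UM
          isomorphism_logic_action[OF M bij_imp_bij_inv[OF bij_limit_map[of w]]]
        by (simp add: \<Phi>_def pull_def nat_structures_def)
      then show ?thesis unfolding isomorphic_def by blast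
    qed
    then have "{w \<in> space samples. \<Phi> w \<in> ?C} = space samples" using pull_in by (auto simp: \<Phi>_def)
    then show ?thesis
      unfolding concentrated_on_def em[OF sets_isomorphism_class[OF L M]]
      by (simp only: S.emeasure_space_1)
  qed
  ultimately show ?thesis using sets by blast
qed

section \<open>Transfer to an arbitrary countable universe\<close>

lemma nat_copy:
  fixes M :: "('r, 'c, 'f, 'a) interpretation_data"
  assumes M: "is_structure L M" and h: "bij_betw h (UNIV :: nat set) (universe M)"
  obtains N where "N \<in> nat_structures L" "isomorphism L N M h"
proof -
  define k where "k = inv_into UNIV h"
  have hk: "h (k x) = x" if "x \<in> universe M" for x
    unfolding k_def using h that by (rule bij_betw_inv_into_right)
  have t: "map h ns \<in> tuples (universe M) n" if "ns \<in> tuples UNIV n" for ns n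
    using h that by (intro map_in_tuples[of h UNIV]) (auto simp: bij_betw_def)
  define N where "N = \<lparr>universe = UNIV,
    rel_of = (\<lambda>R ns. R \<in> rel_symbols L \<and> ns \<in> tuples UNIV (rel_arity L R) \<and> rel_of M R (map h ns)),
    const_of = (\<lambda>c. if c \<in> const_symbols L then k (const_of M c) else undefined),
    fun_of = (\<lambda>f ns. if f \<in> fun_symbols L \<and> ns \<in> tuples UNIV (fun_arity L f)
      then k (fun_of M f (map h ns)) else undefined)\<rparr>"
  have "N \<in> nat_structures L"
    by (simp add: nat_structures_def is_structure_def N_def)
  moreover have "const_of M c \<in> universe M" if "c \<in> const_symbols L" for c
    using M that unfolding is_structure_def by meson
  moreover have "fun_of M f (map h ns) \<in> universe M"
    if "f \<in> fun_symbols L" "ns \<in> tuples UNIV (fun_arity L f)" for f ns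
    using M that(1) t[OF that(2)] unfolding is_structure_def by meson
  ultimately show thesis
    using that[of N] h by (simp add: isomorphism_def N_def hk)
qed

text \<open>Conjugation by \<open>h\<close> turns automorphisms of \<open>M\<close> fixing
  \<open>map h as\<close> into automorphisms of \<open>N\<close> fixing \<open>as\<close>, so
  \<open>h\<close> maps the definable closure of \<open>as\<close> into that of
  \<open>map h as\<close>.\<close>

lemma trivial_definable_closure_isomorphism:
  assumes N: "is_structure L N" and h: "isomorphism L N M h" and dcl: "trivial_definable_closure L M"
  shows "trivial_definable_closure L N"
  unfolding trivial_definable_closure_def
proof (intro allI impI equalityI subsetI)
  fix as b assume as: "set as \<subseteq> universe N"
  let ?k = "inv_into (universe N) h"
  have hb: "bij_betw h (universe N) (universe M)" using h by (simp add: isomorphism_def)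
  show "b \<in> definable_closure L N as" if "b \<in> set as"
    using that as by (auto simp: definable_closure_def)
  assume "b \<in> definable_closure L N as"
  then have b: "b \<in> universe N"
    and fixed: "\<And>u. automorphism L N u \<Longrightarrow> \<forall>a\<in>set as. u a = a \<Longrightarrow> u b = b"
    by (auto simp: definable_closure_def)
  have kh: "?k (h x) = x" if "x \<in> universe N" for x
    using hb that by (rule bij_betw_inv_into_left)
  have hM: "h x \<in> universe M" if "x \<in> universe N" for x
    using bij_betwE[OF hb] that by blast
  have "h b \<in> definable_closure L M (map h as)"
    unfolding definable_closure_def
  proof (intro CollectI conjI allI impI)
    fix q assume q: "automorphism L M q \<and> (\<forall>a\<in>set (map h as). q a = a)"
    have "automorphism L N (?k \<circ> (q \<circ> h))"
      using isomorphism_comp[OF isomorphism_comp[OF h] isomorphism_inv_into[OF N h]] q by blast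
    moreover have "\<forall>a\<in>set as. (?k \<circ> (q \<circ> h)) a = a" using q as kh by auto
    ultimately have "(?k \<circ> (q \<circ> h)) b = b" by (rule fixed)
    then have "h (?k (q (h b))) = h b" by simp
    moreover have "q (h b) \<in> universe M"
      using q hM[OF b] bij_betwE unfolding isomorphism_def by blast
    ultimately show "q (h b) = h b" using bij_betw_inv_into_right[OF hb] by simp
  qed (rule hM[OF b])
  moreover have "set (map h as) \<subseteq> universe M" using as hM by auto
  ultimately have "h b \<in> h ` set as" using dcl unfolding trivial_definable_closure_def by auto
  then show "b \<in> set as" using as b kh by (metis (no_types, lifting) imageE subsetD)
qed

theorem theorem4p4:
  fixes L :: "('r, 'c, 'f) language"
    and M :: "('r, 'c, 'f, 'a) interpretation_data"
  assumes "countable_language L"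
    and "is_structure L M"
    and "countable (universe M)" and "infinite (universe M)"
    and "trivial_definable_closure L M"
  shows "\<exists>\<mu> :: ('r, 'c, 'f, nat) interpretation_data measure.
           sets \<mu> = sets (structure_space L) \<and> prob_space \<mu> \<and>
           invariant_measure L \<mu> \<and> concentrated_on L \<mu> M"
proof -
  have h: "bij_betw (from_nat_into (universe M)) UNIV (universe M)"
    using assms(3,4) by (rule bij_betw_from_nat_into)
  obtain N where N: "N \<in> nat_structures L" "isomorphism L N M (from_nat_into (universe M))"
    using nat_copy[OF assms(2) h] .
  have st: "is_structure L N" using N(1) by (simp add: nat_structures_def)
  \<comment> \<open>Concentration refers to the target only through its isomorphism class, so a
    measure concentrated on the copy \<open>N\<close> is concentrated on \<open>M\<close>.\<close>
  have "isomorphic L K N \<longleftrightarrow> isomorphic L K M" for K :: "('r, 'c, 'f, nat) interpretation_data"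
  proof
    assume "isomorphic L K N"
    then obtain u where "isomorphism L K N u" unfolding isomorphic_def by (rule exE)
    then show "isomorphic L K M" using isomorphism_comp[OF _ N(2)] unfolding isomorphic_def by fast
  next
    assume "isomorphic L K M"
    then obtain u where "isomorphism L K M u" unfolding isomorphic_def by (rule exE)
    then show "isomorphic L K N"
      using isomorphism_comp[OF _ isomorphism_inv_into[OF st N(2)]] unfolding isomorphic_def by fast
  qed
  then have "concentrated_on L \<mu> N \<longleftrightarrow> concentrated_on L \<mu> M" for \<mu>
    by (simp add: concentrated_on_def)
  moreover have "trivial_definable_closure L N"
    by (rule trivial_definable_closure_isomorphism[OF st N(2) assms(5)])
  ultimately show ?thesis
    using exists_invariant_measure_nat[OF assms(1) N(1)] by simp
qed

end
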